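(* Let $\alpha\in(1,2]$, $c_\alpha = \frac{\alpha-1}{\alpha}\vee \sqrt{\frac{2-\alpha}{\alpha}}$, and let $\psi_\alpha:\mathbb R\to\mathbb R$ satisfy $-\log(1-x+c_\alpha |x|^\alpha) \leq \psi_\alpha(x) \leq \log(1+x+c_\alpha |x|^\alpha)$ for all $x\in\mathbb R$. Let $Y_1,\ldots,Y_n\in\mathbb C^{d\times d}$ be independent self-adjoint random matrices with $\|\mathbb E|Y_j|^\alpha\|<\infty$ for all $j$, and let $v_n^\alpha\geq \big\| \sum_{j=1}^n \mathbb E|Y_j|^\alpha \big\|$. Then for any $t>0$ and $\theta>0$, \[ \Pr\Big( \Big\| \sum_{j=1}^n \Big(\frac{1}{\theta}\psi_\alpha(\theta Y_j) - \mathbb E Y_j \Big) \Big\| \geq t \Big)\leq 2d\exp\big( -\theta t + c_\alpha \theta^\alpha v_n^\alpha\big). \]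
   Context: $\|\cdot\|$ is the operator norm; $a\vee b=\max(a,b)$. For a real function $f$ and a self-adjoint matrix $A=U\,\mathrm{diag}(\lambda_i)\,U^\ast$, $f(A):=U\,\mathrm{diag}(f(\lambda_i))\,U^\ast$; in particular $|A|:=U\,\mathrm{diag}(|\lambda_i|)\,U^\ast$ and $|A|^\alpha=U\,\mathrm{diag}(|\lambda_i|^\alpha)\,U^\ast$. Expectations are entrywise. *)

theory Defs
  imports "HOL-Probability.Probability"
begin

definition ctrans :: "complex^'n^'n \<Rightarrow> complex^'n^'n" where
  "ctrans A = (\<chi> i j. cnj (A $ j $ i))"

definition self_adjoint :: "complex^'n^'n \<Rightarrow> bool" where
  "self_adjoint A \<longleftrightarrow> ctrans A = A"

definition unitary_mat :: "complex^'n^'n \<Rightarrow> bool" where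
  "unitary_mat U \<longleftrightarrow> U ** ctrans U = mat 1 \<and> ctrans U ** U = mat 1"

definition diag_mat :: "('n \<Rightarrow> real) \<Rightarrow> complex^'n^'n" where
  "diag_mat l = (\<chi> i j. if i = j then complex_of_real (l i) else 0)"

definition matfun :: "(real \<Rightarrow> real) \<Rightarrow> complex^'n^'n \<Rightarrow> complex^'n^'n" where
  "matfun f A = (let p = (SOME p. unitary_mat (fst p) \<and> A = fst p ** diag_mat (snd p) ** ctrans (fst p))
                 in fst p ** diag_mat (f \<circ> snd p) ** ctrans (fst p))"

definition mabs_powr :: "complex^'n^'n \<Rightarrow> real \<Rightarrow> complex^'n^'n" where
  "mabs_powr A a = matfun (\<lambda>x. \<bar>x\<bar> powr a) A"

definition opnorm :: "complex^'n^'n \<Rightarrow> real" where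
  "opnorm A = onorm (\<lambda>x. A *v x)"

definition c_alpha :: "real \<Rightarrow> real" where
  "c_alpha a = max ((a - 1) / a) (sqrt ((2 - a) / a))"

end

(* With f(x) = log(1 + x + c |x|^alpha), the operator norm of the sum R is at least t only if an
   eigenvalue of theta R or of -theta R is at least theta t, so by the bounds on psi and monotonicity
   of tr exp one of the traces tr exp(sum_j f(+-theta Y_j) -+ theta E Y_j) is at least exp(theta t).
   Its expectation is bounded by integrating out one summand at a time with Lieb's theorem,
   E tr exp(K + log X) <= tr exp(K + log E X), and then by log Z <= Z - 1.

   Lieb's theorem is reduced to the joint convexity of the relative entropy D(T; X) by the Gibbs
   variational principle tr exp H = max_T (tr T H - tr T log T + tr T). Joint convexity follows from
   D(T; X) = int_0^1 (1 - r) <T - X, P_r^{-1} (T - X)> dr, where P_r B = (1 - r) X B + r B T is linear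
   in (T, X) and positive, so that each integrand is a supremum of linear functions of (T, X). *)
theory Submission
  imports Defs
begin

text \<open>The obstacle is noncommutativity: the exponential of a sum is not a product, so
  exponential moments of independent summands do not factor, and Lieb's theorem replaces that
  factorization. The function f is built so that its exponential only involves available moments:
  exp(f(theta Y)) = 1 + theta Y + c theta^alpha |Y|^alpha. The constant c is large enough to keep
  the scalar version of the right side positive for every real argument. After log Z <= Z - 1 the
  terms theta E Y cancel and only the alpha-moments remain. The two signs of an eigenvalue give the
  factor 2, the trace of the identity the factor d. No matrix function is ever differentiated.
  Eigenbases u_i of T and v_j of X are coupled by the weights |<v_j, u_i>|^2, whose row and column
  sums are 1, so that the Gibbs and entropy statements become scalar statements about pairs of
  eigenvalues, averaged with these weights. The norm event is covered by two events formulated with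
  the continuous f, whose measurability follows from continuity of the functional calculus.\<close>

lemma ctrans_nth: "ctrans A $ i $ j = cnj (A $ j $ i)"
  by (simp add: ctrans_def)

lemma ctrans_ctrans [simp]: "ctrans (ctrans A) = A"
  by (simp add: ctrans_def vec_eq_iff)

lemma ctrans_mult: "ctrans (A ** B) = ctrans B ** ctrans A"
  by (simp add: ctrans_def matrix_matrix_mult_def vec_eq_iff mult.commute)

lemma ctrans_add: "ctrans (A + B) = ctrans A + ctrans B"
  by (simp add: ctrans_def vec_eq_iff)

lemma ctrans_scaleR: "ctrans (c *\<^sub>R A) = c *\<^sub>R ctrans A"
  by (simp add: ctrans_def vec_eq_iff)

lemma ctrans_diag_mat [simp]: "ctrans (diag_mat l) = diag_mat l"
  by (auto simp: ctrans_def diag_mat_def vec_eq_iff)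

lemma diag_mat_mult_left: "(diag_mat l ** A) $ i $ j = complex_of_real (l i) * A $ i $ j"
proof -
  have "(diag_mat l ** A) $ i $ j = (\<Sum>k\<in>UNIV. if i = k then complex_of_real (l i) * A $ k $ j else 0)"
    by (simp add: matrix_matrix_mult_def diag_mat_def if_distrib[of "\<lambda>x. x * _"] cong: if_cong)
  then show ?thesis by simp
qed

lemma diag_mat_mult_right: "(A ** diag_mat l) $ i $ j = A $ i $ j * complex_of_real (l j)"
proof -
  have "(A ** diag_mat l) $ i $ j = (\<Sum>k\<in>UNIV. if k = j then A $ i $ k * complex_of_real (l j) else 0)"
    by (simp add: matrix_matrix_mult_def diag_mat_def if_distrib[of "\<lambda>x. _ * x"] cong: if_cong)
  then show ?thesis by simp
qed

lemma linear_ctrans: "linear ctrans"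
  by (intro linearI ctrans_add ctrans_scaleR)

lemma inner_matrix_vector: "x \<bullet> (A *v y) = (ctrans A *v x) \<bullet> (y :: complex^'n)" for A :: "complex^'n^'n"
proof -
  have *: "inner a (b * c) = inner (cnj b * a) c" for a b c :: complex
    by (simp add: inner_complex_def algebra_simps)
  have "x \<bullet> (A *v y) = (\<Sum>i\<in>UNIV. \<Sum>j\<in>UNIV. inner (x$i) (A$i$j * y$j))"
    by (simp add: inner_vec_def matrix_vector_mult_def inner_sum_right)
  also have "\<dots> = (\<Sum>i\<in>UNIV. \<Sum>j\<in>UNIV. inner (cnj (A$i$j) * x$i) (y$j))"
    by (simp add: *)
  also have "\<dots> = (\<Sum>j\<in>UNIV. \<Sum>i\<in>UNIV. inner (cnj (A$i$j) * x$i) (y$j))"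
    by (rule sum.swap)
  also have "\<dots> = (ctrans A *v x) \<bullet> y"
    by (simp add: inner_vec_def matrix_vector_mult_def inner_sum_left ctrans_def)
  finally show ?thesis .
qed

lemma linear_matrix_vector_complex: "linear (\<lambda>x :: complex^'n. (A :: complex^'n^'n) *v x)"
  by (rule linearI) (simp_all add: matrix_vector_mult_def vec_eq_iff sum.distrib algebra_simps scaleR_sum_right)

subsection \<open>The spectral theorem\<close>

definition cinner :: "complex^'n \<Rightarrow> complex^'n \<Rightarrow> complex" where
  "cinner x y = (\<Sum>i\<in>UNIV. cnj (x $ i) * y $ i)"

lemma Re_cinner: "Re (cinner x y) = x \<bullet> y"
  by (simp add: cinner_def inner_vec_def inner_complex_def)

lemma Im_cinner: "Im (cinner x y) = (\<i> *s x) \<bullet> y"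
  by (simp add: cinner_def inner_vec_def inner_complex_def sum_negf sum_subtractf)

lemma cnj_cinner: "cnj (cinner x y) = cinner y x"
  by (simp add: cinner_def mult.commute)

lemma cinner_self: "cinner x x = complex_of_real (x \<bullet> x)"
proof (rule complex_eqI)
  show "Im (cinner x x) = Im (complex_of_real (x \<bullet> x))"
    by (simp add: cinner_def mult.commute)
qed (simp add: Re_cinner)

lemma cinner_matrix_vector: "cinner x (A *v y) = cinner (ctrans A *v x) y"
proof -
  have "cinner x (A *v y) = (\<Sum>i\<in>UNIV. \<Sum>j\<in>UNIV. cnj (x$i) * (A$i$j * y$j))"
    by (simp add: cinner_def matrix_vector_mult_def sum_distrib_left)
  also have "\<dots> = (\<Sum>j\<in>UNIV. \<Sum>i\<in>UNIV. cnj (x$i) * (A$i$j * y$j))"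
    by (rule sum.swap)
  also have "\<dots> = cinner (ctrans A *v x) y"
    by (simp add: cinner_def matrix_vector_mult_def sum_distrib_left sum_distrib_right ctrans_def mult_ac)
  finally show ?thesis .
qed

lemma cinner_diff_right: "cinner x (y - z) = cinner x y - cinner x z"
  by (simp add: cinner_def right_diff_distrib sum_subtractf)

lemma cinner_add_right: "cinner x (y + z) = cinner x y + cinner x z"
  by (simp add: cinner_def distrib_left sum.distrib)

lemma cinner_scaleR_right: "cinner x (c *\<^sub>R y) = c *\<^sub>R cinner x y"
  by (simp add: cinner_def scaleR_sum_right)

lemma cinner_scaleR_left: "cinner (c *\<^sub>R x) y = c *\<^sub>R cinner x y"
  by (simp add: cinner_def scaleR_sum_right)

text \<open>One complex condition is two real ones, orthogonality to \<open>v\<close> and to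
  \<open>\<i> *s v\<close>. There are at most \<open>2 * card V\<close> of them, fewer than the real
  dimension \<open>2 * CARD('n)\<close>.\<close>

lemma cinner_orthogonal_exists:
  fixes V :: "(complex^'n) set"
  assumes "finite V" "card V < CARD('n)"
  obtains x :: "complex^'n" where "norm x = 1" "\<And>v. v \<in> V \<Longrightarrow> cinner v x = 0"
proof -
  let ?W = "V \<union> (\<lambda>v. \<i> *s v) ` V"
  have "dim ?W \<le> card ?W"
    using assms(1) by (intro dim_le_card') auto
  also have "\<dots> \<le> card V + card ((\<lambda>v. \<i> *s v) ` V)"
    by (rule card_Un_le)
  also have "\<dots> \<le> card V + card V"
    using assms(1) by (intro add_mono card_image_le) auto
  also have "\<dots> < DIM(complex^'n)"
    using assms(2) by simp
  finally obtain x :: "complex^'n" where x: "x \<noteq> 0" "\<And>y. y \<in> span ?W \<Longrightarrow> orthogonal x y"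
    using orthogonal_to_subspace_exists by blast
  show ?thesis
  proof
    show "norm (x /\<^sub>R norm x) = 1"
      using x(1) by simp
    fix v assume v: "v \<in> V"
    have "orthogonal x v" "orthogonal x (\<i> *s v)"
      using v by (auto intro!: x(2) span_base)
    then have "cinner v x = 0"
      by (intro complex_eqI) (auto simp: Re_cinner Im_cinner orthogonal_def inner_commute)
    then show "cinner v (x /\<^sub>R norm x) = 0"
      by (simp add: cinner_scaleR_right)
  qed
qed

text \<open>Variational proof: the quadratic form attains its maximum on the compact set of unit
  vectors orthogonal to \<open>V\<close>. By \<open>inv\<close> the residual
  \<open>A *v x - \<mu> *\<^sub>R x\<close> is again orthogonal to \<open>V\<close>, hence an
  admissible direction of perturbation, and the first variation forces it to vanish.\<close>

lemma rayleigh_eigenvector: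
  fixes A :: "complex^'n^'n" and V :: "(complex^'n) set"
  assumes sa: "self_adjoint A"
    and inv: "\<And>v x. v \<in> V \<Longrightarrow> \<forall>w\<in>V. cinner w x = 0 \<Longrightarrow> cinner v (A *v x) = 0"
    and x0: "norm x0 = 1" "\<And>v. v \<in> V \<Longrightarrow> cinner v x0 = 0"
  obtains x \<mu> where "norm x = 1" "\<And>v. v \<in> V \<Longrightarrow> cinner v x = 0" "A *v x = \<mu> *\<^sub>R x"
proof -
  let ?S = "{x :: complex^'n. norm x = 1} \<inter> {x. \<forall>v\<in>V. cinner v x = 0}"
  have cont: "continuous_on UNIV (\<lambda>x. cinner v x)" for v :: "complex^'n"
    unfolding cinner_def by (intro continuous_intros)
  have "{x. \<forall>v\<in>V. cinner v x = 0} = (\<Inter>v\<in>V. {x. cinner v x = 0})" by auto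
  moreover have "closed {x. cinner v x = 0}" for v :: "complex^'n"
    by (intro closed_Collect_eq cont continuous_on_const)
  ultimately have cl: "closed {x :: complex^'n. \<forall>v\<in>V. cinner v x = 0}"
    by (auto intro!: closed_INT)
  have "compact {x :: complex^'n. norm x = 1}"
    using compact_sphere[of "0 :: complex^'n" 1] by (simp add: sphere_def dist_norm)
  then have comp: "compact ?S"
    using cl by (rule compact_Int_closed)
  have lin: "linear ((*v) A)"
    by (rule linear_matrix_vector_complex)
  have contA: "continuous_on UNIV (\<lambda>x. x \<bullet> (A *v x))"
    by (intro continuous_intros linear_continuous_on)
       (use lin in \<open>simp add: linear_conv_bounded_linear\<close>)
  obtain x where x: "x \<in> ?S" "\<And>y. y \<in> ?S \<Longrightarrow> y \<bullet> (A *v y) \<le> x \<bullet> (A *v x)"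
    using continuous_attains_sup[OF comp _ continuous_on_subset[OF contA subset_UNIV]] x0
    by blast
  define \<mu> where "\<mu> = x \<bullet> (A *v x)"
  define y where "y = A *v x - \<mu> *\<^sub>R x"
  have xn: "norm x = 1" and xV: "\<forall>v\<in>V. cinner v x = 0"
    using x(1) by auto
  have xx: "x \<bullet> x = 1"
    using xn by (simp add: dot_square_norm)
  have yV: "\<forall>v\<in>V. cinner v y = 0"
    using xV inv by (simp add: y_def cinner_diff_right cinner_scaleR_right)
  have bound: "z \<bullet> (A *v z) \<le> \<mu> * (z \<bullet> z)" if "\<forall>v\<in>V. cinner v z = 0" for z
  proof (cases "z = 0")
    case False
    have "(z /\<^sub>R norm z) \<bullet> (A *v (z /\<^sub>R norm z)) \<le> \<mu>"
      unfolding \<mu>_def using False that by (intro x(2)) (auto simp: cinner_scaleR_right)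
    moreover have "A *v (z /\<^sub>R norm z) = (A *v z) /\<^sub>R norm z"
      using linear_cmul[OF lin] by simp
    ultimately have "(z \<bullet> (A *v z)) / (norm z * norm z) \<le> \<mu>"
      by (simp add: field_simps)
    then show ?thesis
      using False by (simp add: dot_square_norm power2_eq_square field_simps)
  qed (simp add: linear_0[OF lin])
  have sym: "u \<bullet> (A *v w) = w \<bullet> (A *v u)" for u w
    using sa inner_matrix_vector[of u A w] by (simp add: self_adjoint_def inner_commute)
  have xy: "x \<bullet> (A *v y) = y \<bullet> y + \<mu> * (x \<bullet> y)"
    by (subst sym) (simp add: y_def algebra_simps inner_commute)
  \<comment> \<open>The perturbed vector \<open>x + e *\<^sub>R y\<close> still obeys
    \<open>bound\<close>. The terms of order zero cancel by maximality at \<open>x\<close>, and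
    \<open>2 * e * (y \<bullet> y)\<close> is the first variation.\<close>
  have quad: "2 * e * (y \<bullet> y) + e\<^sup>2 * (y \<bullet> (A *v y) - \<mu> * (y \<bullet> y)) \<le> 0" for e
  proof -
    have "\<forall>v\<in>V. cinner v (x + e *\<^sub>R y) = 0"
      using xV yV by (simp add: cinner_add_right cinner_scaleR_right)
    from bound[OF this]
    have "(x + e *\<^sub>R y) \<bullet> (A *v x + e *\<^sub>R (A *v y)) \<le> \<mu> * ((x + e *\<^sub>R y) \<bullet> (x + e *\<^sub>R y))"
      using linear_add[OF lin] linear_cmul[OF lin] by simp
    then show ?thesis
      using xy xx sym[of y x]
      by (simp add: inner_add_left inner_add_right algebra_simps power2_eq_square inner_commute[of y x] flip: \<mu>_def)
  qed
  have "y \<bullet> y \<le> 0"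
  proof (rule ccontr)
    assume "\<not> y \<bullet> y \<le> 0"
    then have p: "y \<bullet> y > 0" by (metis not_le)
    define a where "a = y \<bullet> (A *v y) - \<mu> * (y \<bullet> y)"
    \<comment> \<open>Small enough that the quadratic term, at most
      \<open>e * \<bar>a\<bar> \<le> y \<bullet> y\<close> after division by \<open>e\<close>,
      cannot offset \<open>2 * (y \<bullet> y)\<close>.\<close>
    define e where "e = (y \<bullet> y) / (\<bar>a\<bar> + 1)"
    have e: "e > 0" using p by (simp add: e_def)
    have "e * (2 * (y \<bullet> y) + e * a) \<le> 0"
      using quad[of e] by (simp add: a_def power2_eq_square algebra_simps)
    then have "2 * (y \<bullet> y) + e * a \<le> 0"
      using e by (simp add: mult_le_0_iff)
    moreover have "e * \<bar>a\<bar> \<le> y \<bullet> y"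
      using p by (simp add: e_def field_simps)
    moreover have "- (e * \<bar>a\<bar>) \<le> e * a"
      using e by (metis abs_ge_minus_self abs_mult abs_of_pos minus_le_iff)
    ultimately show False using p by linarith
  qed
  then have "y = 0" by (metis inner_gt_zero_iff not_le)
  then show ?thesis
    using that[of x \<mu>] xn xV by (simp add: y_def)
qed

text \<open>The orthogonal complement of the eigenvectors found so far is invariant under a
  self-adjoint matrix, so another one can be found inside it. Indexing by subsets of
  \<open>'n\<close> makes the family for \<open>UNIV\<close> the columns of a square matrix.\<close>

lemma eigenvectors_partial:
  fixes A :: "complex^'n^'n" and I :: "'n set"
  assumes sa: "self_adjoint A"
  shows "\<exists>v l. (\<forall>i\<in>I. A *v v i = (l i :: real) *\<^sub>R v i) \<and>
           (\<forall>i\<in>I. \<forall>j\<in>I. cinner (v i) (v j) = (if i = j then 1 else 0))"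
    (is "\<exists>v l. ?P I v l")
proof -
  have "finite I" by simp
  then show ?thesis
  proof (induction I rule: finite_induct)
    case (insert k I)
    then obtain v l where vl: "?P I v l" by blast
    have "card (v ` I) \<le> card I" by (rule card_image_le) simp
    also have "card I < CARD('n)"
      using insert(2) by (intro psubset_card_mono) auto
    finally obtain x0 where x0: "norm x0 = 1" "\<And>w. w \<in> v ` I \<Longrightarrow> cinner w x0 = 0"
      using cinner_orthogonal_exists[of "v ` I"] by auto
    have "cinner w (A *v x) = 0" if "w \<in> v ` I" "\<forall>w\<in>v ` I. cinner w x = 0" for w x
    proof -
      have "ctrans A *v w = A *v w"
        using sa by (simp add: self_adjoint_def)
      then show ?thesis
        using that vl by (auto simp: cinner_matrix_vector cinner_scaleR_left)
    qed
    from rayleigh_eigenvector[OF sa this x0]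
    obtain x \<mu> where x: "norm x = 1" "\<And>w. w \<in> v ` I \<Longrightarrow> cinner w x = 0" "A *v x = \<mu> *\<^sub>R x"
      by blast
    have "cinner x w = 0" if "w \<in> v ` I" for w
      using x(2)[OF that] cnj_cinner[of w x] by simp
    moreover have "cinner x x = 1"
      using x(1) by (simp add: cinner_self dot_square_norm)
    ultimately have "?P (insert k I) (v(k := x)) (l(k := \<mu>))"
      using vl x insert(2) by (auto split: if_splits)
    then show ?case by blast
  qed auto
qed

text \<open>Kept as a relation with an explicit \<open>U\<close>: matrices diagonalised by the same
  \<open>U\<close> are added, multiplied and compared through their eigenvalue functions
  alone.\<close>

definition spectral_decomp :: "complex^'n^'n \<Rightarrow> ('n \<Rightarrow> real) \<Rightarrow> complex^'n^'n \<Rightarrow> bool" where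
  "spectral_decomp U l A \<longleftrightarrow> unitary_mat U \<and> A = U ** diag_mat l ** ctrans U"

theorem spectral_theorem:
  fixes A :: "complex^'n^'n"
  assumes "self_adjoint A"
  obtains U l where "spectral_decomp U l A"
proof -
  obtain v :: "'n \<Rightarrow> complex^'n" and l where v: "\<forall>i. A *v v i = (l i :: real) *\<^sub>R v i"
      "\<forall>i j. cinner (v i) (v j) = (if i = j then 1 else 0)"
    using eigenvectors_partial[OF assms, of UNIV] by auto
  define U where "U = (\<chi> i j. v j $ i)"
  have 1: "ctrans U ** U = mat 1"
    using v(2) by (simp add: vec_eq_iff matrix_matrix_mult_def ctrans_def U_def mat_def cinner_def)
  then have 2: "U ** ctrans U = mat 1"
    by (rule matrix_left_right_inverse[THEN iffD1])
  have "A ** U = U ** diag_mat l"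
  proof -
    have "(A ** U) $ i $ j = (A *v v j) $ i" for i j
      by (simp add: U_def matrix_matrix_mult_def matrix_vector_mult_def)
    moreover have "(U ** diag_mat l) $ i $ j = (l j *\<^sub>R v j) $ i" for i j
      unfolding diag_mat_mult_right by (simp add: U_def) (simp add: scaleR_conv_of_real mult.commute)
    ultimately show ?thesis
      using v(1) by (simp add: vec_eq_iff)
  qed
  then have "A ** (U ** ctrans U) = U ** diag_mat l ** ctrans U"
    by (simp add: matrix_mul_assoc)
  then show ?thesis
    using 1 2 by (intro that[of U l]) (simp add: spectral_decomp_def unitary_mat_def)
qed

subsection \<open>Functional calculus\<close>

lemma unitary_matD:
  assumes "unitary_mat U"
  shows "U ** ctrans U = mat 1" "ctrans U ** U = mat 1"
  using assms by (auto simp: unitary_mat_def)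

lemma unitary_mat_ctrans: "unitary_mat U \<Longrightarrow> unitary_mat (ctrans U)"
  by (simp add: unitary_mat_def)

lemma unitary_mat_mult:
  assumes "unitary_mat U" "unitary_mat V"
  shows "unitary_mat (U ** V)"
proof -
  have "U ** V ** (ctrans V ** ctrans U) = U ** (V ** ctrans V) ** ctrans U"
    "ctrans V ** ctrans U ** (U ** V) = ctrans V ** (ctrans U ** U) ** V"
    by (simp_all only: matrix_mul_assoc)
  then show ?thesis
    using assms by (simp add: unitary_mat_def ctrans_mult)
qed

lemma unitary_conj_cancel:
  assumes "unitary_mat U"
  shows "(A ** ctrans U) ** (U ** B) = A ** B" "(A ** U) ** (ctrans U ** B) = A ** B"
proof -
  have "(A ** ctrans U) ** (U ** B) = A ** (ctrans U ** U) ** B"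
    "(A ** U) ** (ctrans U ** B) = A ** (U ** ctrans U) ** B"
    by (simp_all only: matrix_mul_assoc)
  then show "(A ** ctrans U) ** (U ** B) = A ** B" "(A ** U) ** (ctrans U ** B) = A ** B"
    using assms by (simp_all add: unitary_mat_def)
qed

lemma diag_mat_one: "diag_mat (\<lambda>_. 1) = mat 1"
  by (simp add: vec_eq_iff diag_mat_def mat_def)

lemma mat_one_nth_diag: "(mat 1 :: complex^'n^'n) $ i $ i = 1"
  by (simp add: mat_def)

lemma diag_mat_mult: "diag_mat a ** diag_mat b = diag_mat (\<lambda>i. a i * b i)"
  by (simp add: vec_eq_iff diag_mat_mult_left) (simp add: diag_mat_def)

lemma diag_mat_add: "diag_mat a + diag_mat b = diag_mat (\<lambda>i. a i + b i)"
  by (simp add: vec_eq_iff diag_mat_def)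

lemma diag_mat_scaleR: "c *\<^sub>R diag_mat a = diag_mat (\<lambda>i. c * a i)"
  by (simp add: vec_eq_iff diag_mat_def) (simp add: scaleR_conv_of_real)

lemma matrix_add_mult_rdistrib: "(A + B) ** C = A ** C + B ** C" for A B C :: "complex^'n^'n"
  by (simp add: vec_eq_iff matrix_matrix_mult_def distrib_right sum.distrib)

lemma matrix_mult_scaleR:
  fixes A B :: "complex^'n^'n"
  shows "(c *\<^sub>R A) ** B = c *\<^sub>R (A ** B)" "A ** (c *\<^sub>R B) = c *\<^sub>R (A ** B)"
  by (simp_all add: vec_eq_iff matrix_matrix_mult_def scaleR_sum_right)

lemma self_adjoint_spectral: "spectral_decomp U l A \<Longrightarrow> self_adjoint A"
  by (simp add: spectral_decomp_def self_adjoint_def ctrans_mult matrix_mul_assoc)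

lemma spectral_decomp_one: "unitary_mat U \<Longrightarrow> spectral_decomp U (\<lambda>_. 1) (mat 1)"
  by (simp add: spectral_decomp_def diag_mat_one unitary_matD)

lemma spectral_decomp_add:
  "spectral_decomp U a A \<Longrightarrow> spectral_decomp U b B \<Longrightarrow> spectral_decomp U (\<lambda>i. a i + b i) (A + B)"
  by (simp add: spectral_decomp_def flip: diag_mat_add) (simp add: matrix_add_ldistrib matrix_add_mult_rdistrib)

lemma spectral_decomp_scaleR:
  "spectral_decomp U a A \<Longrightarrow> spectral_decomp U (\<lambda>i. c * a i) (c *\<^sub>R A)"
  by (simp add: spectral_decomp_def matrix_mult_scaleR flip: diag_mat_scaleR)

lemma spectral_decomp_mult:
  "spectral_decomp U a A \<Longrightarrow> spectral_decomp U b B \<Longrightarrow> spectral_decomp U (\<lambda>i. a i * b i) (A ** B)"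
  unfolding spectral_decomp_def diag_mat_mult[symmetric]
  by (metis unitary_conj_cancel(1) matrix_mul_assoc)

text \<open>Independence of the decomposition chosen by \<open>SOME\<close> in
  \<open>matfun\<close>. The matrix \<open>W\<close> intertwines the two diagonal matrices, so a
  nonzero entry \<open>W $ i $ j\<close> forces \<open>m j = l i\<close>, hence
  \<open>f (m j) = f (l i)\<close>, and \<open>W\<close> intertwines the transformed diagonals
  too.\<close>

lemma matfun_spectral:
  fixes A U :: "complex^'n^'n"
  assumes "spectral_decomp U l A"
  shows "spectral_decomp U (f \<circ> l) (matfun f A)"
proof -
  define p where "p = (SOME p. unitary_mat (fst p) \<and> A = fst p ** diag_mat (snd p) ** ctrans (fst p))"
  have "unitary_mat (fst p) \<and> A = fst p ** diag_mat (snd p) ** ctrans (fst p)"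
    unfolding p_def by (rule someI[of _ "(U, l)"]) (use assms in \<open>simp add: spectral_decomp_def\<close>)
  then obtain V m where p: "p = (V, m)" "unitary_mat V" "A = V ** diag_mat m ** ctrans V"
    by (metis fst_conv snd_conv surj_pair)
  have U: "unitary_mat U" "A = U ** diag_mat l ** ctrans U"
    using assms by (auto simp: spectral_decomp_def)
  define W where "W = ctrans U ** V"
  have eq: "W ** diag_mat m = diag_mat l ** W"
  proof -
    have "W ** diag_mat m = ctrans U ** A ** V"
      by (simp add: W_def p(3) matrix_mul_assoc[symmetric] unitary_matD[OF p(2)])
    also have "\<dots> = diag_mat l ** W"
      by (simp add: W_def U(2) matrix_mul_assoc unitary_matD[OF U(1)])
    finally show ?thesis .
  qed
  have "W ** diag_mat (f \<circ> m) = diag_mat (f \<circ> l) ** W"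
  proof -
    have "W $ i $ j * of_real (f (m j)) = of_real (f (l i)) * W $ i $ j" for i j
    proof -
      have "(W ** diag_mat m) $ i $ j = (diag_mat l ** W) $ i $ j"
        by (simp add: eq)
      then show ?thesis
        by (cases "W $ i $ j = 0") (auto simp: diag_mat_mult_left diag_mat_mult_right mult.commute)
    qed
    then show ?thesis
      by (simp add: vec_eq_iff diag_mat_mult_left diag_mat_mult_right)
  qed
  then have "U ** (W ** diag_mat (f \<circ> m)) ** ctrans V = U ** (diag_mat (f \<circ> l) ** W) ** ctrans V"
    by simp
  then have "V ** diag_mat (f \<circ> m) ** ctrans V = U ** diag_mat (f \<circ> l) ** ctrans U"
    by (simp add: W_def matrix_mul_assoc unitary_matD[OF U(1)])
       (simp add: matrix_mul_assoc[symmetric] unitary_matD[OF p(2)])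
  moreover have "matfun f A = V ** diag_mat (f \<circ> m) ** ctrans V"
    unfolding matfun_def p_def[symmetric] Let_def by (simp add: p(1))
  ultimately show ?thesis
    using U(1) by (simp add: spectral_decomp_def)
qed

lemma self_adjoint_matfun: "self_adjoint A \<Longrightarrow> self_adjoint (matfun f A)"
  by (metis matfun_spectral self_adjoint_spectral spectral_theorem)

lemma matfun_matfun:
  assumes "self_adjoint A"
  shows "matfun f (matfun g A) = matfun (\<lambda>x. f (g x)) A"
proof -
  obtain U l where "spectral_decomp U l A" using spectral_theorem[OF assms] .
  then have "spectral_decomp U (f \<circ> (g \<circ> l)) (matfun f (matfun g A))"
    "spectral_decomp U ((\<lambda>x. f (g x)) \<circ> l) (matfun (\<lambda>x. f (g x)) A)"
    by (auto intro!: matfun_spectral)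
  then show ?thesis by (simp add: spectral_decomp_def o_def)
qed

lemma matfun_add:
  assumes "self_adjoint A"
  shows "matfun f A + matfun g A = matfun (\<lambda>x. f x + g x) A"
proof -
  obtain U l where "spectral_decomp U l A" using spectral_theorem[OF assms] .
  then show ?thesis
    using spectral_decomp_add[OF matfun_spectral[of U l A f] matfun_spectral[of U l A g]]
      matfun_spectral[of U l A "\<lambda>x. f x + g x"]
    by (simp add: spectral_decomp_def o_def)
qed

lemma matfun_scaleR:
  assumes "self_adjoint A"
  shows "c *\<^sub>R matfun f A = matfun (\<lambda>x. c * f x) A"
proof -
  obtain U l where "spectral_decomp U l A" using spectral_theorem[OF assms] .
  then show ?thesis
    using spectral_decomp_scaleR[OF matfun_spectral[of U l A f], of c]
      matfun_spectral[of U l A "\<lambda>x. c * f x"]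
    by (simp add: spectral_decomp_def o_def)
qed

lemma matfun_scaleR_arg:
  assumes "self_adjoint A"
  shows "matfun f (c *\<^sub>R A) = matfun (\<lambda>x. f (c * x)) A"
proof -
  obtain U l where "spectral_decomp U l A" using spectral_theorem[OF assms] .
  then show ?thesis
    using matfun_spectral[OF spectral_decomp_scaleR[of U l A c], of f]
      matfun_spectral[of U l A "\<lambda>x. f (c * x)"]
    by (simp add: spectral_decomp_def o_def)
qed

lemma matfun_one:
  assumes "self_adjoint A"
  shows "matfun (\<lambda>_. 1) A = mat 1"
proof -
  obtain U l where "spectral_decomp U l A" using spectral_theorem[OF assms] .
  then show ?thesis
    using matfun_spectral[of U l A "\<lambda>_. 1"] by (simp add: spectral_decomp_def o_def diag_mat_one unitary_matD)
qed

lemma matfun_ident: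
  assumes "self_adjoint A"
  shows "matfun (\<lambda>x. x) A = A"
proof -
  obtain U l where "spectral_decomp U l A" using spectral_theorem[OF assms] .
  then show ?thesis
    using matfun_spectral[of U l A "\<lambda>x. x"] by (simp add: spectral_decomp_def o_def)
qed

lemma self_adjoint_add: "self_adjoint A \<Longrightarrow> self_adjoint B \<Longrightarrow> self_adjoint (A + B)"
  by (simp add: self_adjoint_def ctrans_add)

lemma self_adjoint_scaleR: "self_adjoint A \<Longrightarrow> self_adjoint (c *\<^sub>R A)"
  by (simp add: self_adjoint_def ctrans_scaleR)

lemma self_adjoint_diff: "self_adjoint A \<Longrightarrow> self_adjoint B \<Longrightarrow> self_adjoint (A - B)"
  using self_adjoint_add[of A "(-1) *\<^sub>R B"] self_adjoint_scaleR[of B "-1"] by simp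

lemma self_adjoint_zero: "self_adjoint 0"
  by (simp add: self_adjoint_def ctrans_def vec_eq_iff)

lemma self_adjoint_one: "self_adjoint (mat 1)"
  by (auto simp: self_adjoint_def ctrans_def vec_eq_iff mat_def)

lemma self_adjoint_sum: "(\<And>i. i \<in> I \<Longrightarrow> self_adjoint (A i)) \<Longrightarrow> self_adjoint (\<Sum>i\<in>I. A i)"
  by (induction I rule: infinite_finite_induct) (auto simp: self_adjoint_zero self_adjoint_add)

subsection \<open>Traces\<close>

abbreviation retrace :: "complex^'n^'n \<Rightarrow> real" where
  "retrace A \<equiv> Re (trace A)"

lemma linear_retrace: "linear (retrace :: complex^'n^'n \<Rightarrow> real)"
  by (rule linearI) (simp_all add: trace_def sum.distrib scaleR_sum_right sum_distrib_left)

lemma diag_conj_nth: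
  "(C ** diag_mat m ** ctrans C) $ i $ i = of_real (\<Sum>j\<in>UNIV. (cmod (C $ i $ j))\<^sup>2 * m j)"
proof -
  have "(C ** diag_mat m ** ctrans C) $ i $ i = (\<Sum>j\<in>UNIV. (C ** diag_mat m) $ i $ j * ctrans C $ j $ i)"
    by (simp add: matrix_matrix_mult_def)
  also have "\<dots> = (\<Sum>j\<in>UNIV. of_real ((cmod (C $ i $ j))\<^sup>2 * m j))"
    by (intro sum.cong)
       (simp_all add: diag_mat_mult_right ctrans_nth mult_ac complex_norm_square del: of_real_power)
  finally show ?thesis by simp
qed

lemma unitary_row_sum: "unitary_mat W \<Longrightarrow> (\<Sum>j\<in>UNIV. (cmod (W $ i $ j))\<^sup>2) = 1"
  using diag_conj_nth[of W "\<lambda>_. 1" i]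
  by (simp add: diag_mat_one unitary_matD mat_one_nth_diag del: of_real_sum)

lemma unitary_col_sum: "unitary_mat W \<Longrightarrow> (\<Sum>i\<in>UNIV. (cmod (W $ i $ j))\<^sup>2) = 1"
  using unitary_row_sum[OF unitary_mat_ctrans, of W j] by (simp add: ctrans_nth)

lemma trace_diag_mat_mult: "trace (diag_mat t ** A) = (\<Sum>i\<in>UNIV. of_real (t i) * A $ i $ i)"
  by (simp add: trace_def diag_mat_mult_left)

lemma trace_spectral_mult:
  assumes "spectral_decomp U t T"
  shows "trace (T ** A) = (\<Sum>i\<in>UNIV. of_real (t i) * (ctrans U ** A ** U) $ i $ i)"
proof -
  have "trace (T ** A) = trace (U ** (diag_mat t ** (ctrans U ** A)))"
    using assms by (simp add: spectral_decomp_def matrix_mul_assoc)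
  also have "\<dots> = trace (diag_mat t ** (ctrans U ** A ** U))"
    by (subst trace_mul_sym) (simp add: matrix_mul_assoc)
  finally show ?thesis by (simp add: trace_diag_mat_mult)
qed

lemma trace_spectral:
  assumes "spectral_decomp U l A"
  shows "trace A = of_real (\<Sum>i\<in>UNIV. l i)"
proof -
  have "unitary_mat U" using assms by (simp add: spectral_decomp_def)
  then show ?thesis
    using trace_spectral_mult[OF assms, of "mat 1"] by (simp add: unitary_matD mat_one_nth_diag)
qed

text \<open>The squared overlaps of the two eigenbases act as a coupling of the spectra. They form a
  doubly stochastic matrix (\<open>unitary_weights\<close>), so traces of one matrix alone can be
  written as sums over the same pairs of eigenvalues.\<close>

lemma retrace_spectral_mult2:
  assumes "spectral_decomp U t T" "spectral_decomp V m A"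
  shows "retrace (T ** A) = (\<Sum>i\<in>UNIV. \<Sum>j\<in>UNIV. (cmod ((ctrans U ** V) $ i $ j))\<^sup>2 * (t i * m j))"
proof -
  have "ctrans U ** A ** U = (ctrans U ** V) ** diag_mat m ** ctrans (ctrans U ** V)"
    using assms(2) by (simp add: spectral_decomp_def ctrans_mult matrix_mul_assoc)
  then show ?thesis
    unfolding trace_spectral_mult[OF assms(1)]
    by (simp add: diag_conj_nth sum_distrib_left mult_ac del: of_real_sum)
qed

lemma unitary_weights:
  assumes "unitary_mat U" "unitary_mat V"
  shows "(\<Sum>i\<in>UNIV. \<Sum>j\<in>UNIV. (cmod ((ctrans U ** V) $ i $ j))\<^sup>2 * a i) = (\<Sum>i\<in>UNIV. a i)"
    "(\<Sum>i\<in>UNIV. \<Sum>j\<in>UNIV. (cmod ((ctrans U ** V) $ i $ j))\<^sup>2 * b j) = (\<Sum>j\<in>UNIV. b j)"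
proof -
  have W: "unitary_mat (ctrans U ** V)"
    using assms by (intro unitary_mat_mult unitary_mat_ctrans)
  show "(\<Sum>i\<in>UNIV. \<Sum>j\<in>UNIV. (cmod ((ctrans U ** V) $ i $ j))\<^sup>2 * a i) = (\<Sum>i\<in>UNIV. a i)"
    by (simp add: unitary_row_sum[OF W] flip: sum_distrib_right)
  show "(\<Sum>i\<in>UNIV. \<Sum>j\<in>UNIV. (cmod ((ctrans U ** V) $ i $ j))\<^sup>2 * b j) = (\<Sum>j\<in>UNIV. b j)"
    by (subst sum.swap) (simp add: unitary_col_sum[OF W] flip: sum_distrib_right)
qed

text \<open>The inner product here is the real part of the sesquilinear one, which loses nothing for
  self-adjoint matrices; on these the relation is the Loewner order. Self-adjointness is assumed
  separately where it matters.\<close>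

definition loewner_le :: "complex^'n^'n \<Rightarrow> complex^'n^'n \<Rightarrow> bool" where
  "loewner_le A B \<longleftrightarrow> (\<forall>x. x \<bullet> (A *v x) \<le> x \<bullet> (B *v x))"

definition posdef :: "complex^'n^'n \<Rightarrow> bool" where
  "posdef A \<longleftrightarrow> self_adjoint A \<and> (\<forall>x. x \<noteq> 0 \<longrightarrow> 0 < x \<bullet> (A *v x))"

lemma conj_nth_quadratic:
  "Re ((ctrans U ** A ** U) $ i $ i) = column i U \<bullet> (A *v column i U)"
proof -
  have "(ctrans U ** A ** U) $ i $ i = cinner (column i U) (A *v column i U)"
    unfolding matrix_mul_assoc[symmetric]
    by (simp add: cinner_def matrix_matrix_mult_def matrix_vector_mult_def ctrans_def column_def)
  then show ?thesis by (simp add: Re_cinner)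
qed

lemma norm_column_unitary:
  assumes "unitary_mat U"
  shows "norm (column i U) = 1"
proof -
  have "(\<Sum>k\<in>UNIV. (norm (column i U $ k))\<^sup>2) = 1"
    using unitary_col_sum[OF assms, of i] by (simp add: column_def)
  then show ?thesis by (simp add: norm_vec_def L2_set_def)
qed

lemma eigenvalue_quadratic:
  assumes "spectral_decomp U l A"
  shows "column i U \<bullet> (A *v column i U) = l i"
proof -
  have "unitary_mat U" and A: "A = U ** diag_mat l ** ctrans U"
    using assms by (auto simp: spectral_decomp_def)
  then have "ctrans U ** A ** U = diag_mat l"
    by (simp add: A matrix_mul_assoc unitary_matD)
       (simp add: matrix_mul_assoc[symmetric] unitary_matD)
  then show ?thesis
    by (simp add: conj_nth_quadratic[symmetric]) (simp add: diag_mat_def)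
qed

lemma posdef_spectral_pos:
  assumes "posdef A" "spectral_decomp U l A"
  shows "l i > 0"
proof -
  have "column i U \<noteq> 0"
    using norm_column_unitary[of U i] assms(2) by (auto simp: spectral_decomp_def)
  then show ?thesis
    using assms(1) eigenvalue_quadratic[OF assms(2), of i] by (auto simp: posdef_def)
qed

lemma spectral_quadratic:
  fixes A :: "complex^'n^'n"
  assumes "spectral_decomp U l A"
  shows "x \<bullet> (A *v x) = (\<Sum>i\<in>UNIV. l i * (cmod ((ctrans U *v x) $ i))\<^sup>2)"
    and "x \<bullet> x = (\<Sum>i\<in>UNIV. (cmod ((ctrans U *v x) $ i))\<^sup>2)"
proof -
  have U: "unitary_mat U" and A: "A = U ** diag_mat l ** ctrans U"
    using assms by (auto simp: spectral_decomp_def)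
  have gen: "x \<bullet> ((U ** diag_mat m ** ctrans U) *v x) = (\<Sum>i\<in>UNIV. m i * (cmod ((ctrans U *v x) $ i))\<^sup>2)" for m
  proof -
    have diag: "diag_mat m *v y = (\<chi> i. of_real (m i) * y $ i)" for y :: "complex^'n"
      by (simp add: vec_eq_iff matrix_vector_mult_def diag_mat_def if_distrib[of "\<lambda>a :: complex. a * _"] cong: if_cong)
    have "x \<bullet> ((U ** diag_mat m ** ctrans U) *v x) = (ctrans U *v x) \<bullet> (diag_mat m *v (ctrans U *v x))"
      by (simp add: inner_matrix_vector[of x U, symmetric] matrix_vector_mul_assoc matrix_mul_assoc)
    also have "\<dots> = (\<Sum>i\<in>UNIV. m i * (cmod ((ctrans U *v x) $ i))\<^sup>2)"
      unfolding diag inner_vec_def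
      by (intro sum.cong) (simp_all add: inner_complex_def cmod_power2 algebra_simps, simp add: power2_eq_square)
    finally show ?thesis .
  qed
  show "x \<bullet> (A *v x) = (\<Sum>i\<in>UNIV. l i * (cmod ((ctrans U *v x) $ i))\<^sup>2)"
    using gen[of l] by (simp add: A)
  show "x \<bullet> x = (\<Sum>i\<in>UNIV. (cmod ((ctrans U *v x) $ i))\<^sup>2)"
    using gen[of "\<lambda>_. 1"] by (simp add: diag_mat_one unitary_matD[OF U])
qed

lemma posdefI:
  assumes "spectral_decomp U l A" "\<And>i. l i > 0"
  shows "posdef A"
  unfolding posdef_def
proof (intro conjI allI impI)
  show "self_adjoint A" using assms(1) by (rule self_adjoint_spectral)
  fix x :: "complex^'a" assume "x \<noteq> 0"
  have "x \<bullet> (A *v x) \<noteq> 0 \<and> x \<bullet> (A *v x) \<ge> 0"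
  proof
    show "x \<bullet> (A *v x) \<ge> 0"
      using assms(2)[THEN less_imp_le]
      by (auto simp: spectral_quadratic(1)[OF assms(1)] intro!: sum_nonneg mult_nonneg_nonneg)
    show "x \<bullet> (A *v x) \<noteq> 0"
    proof
      assume "x \<bullet> (A *v x) = 0"
      then have "l i * (cmod ((ctrans U *v x) $ i))\<^sup>2 = 0" for i
        unfolding spectral_quadratic(1)[OF assms(1)]
        by (subst (asm) sum_nonneg_eq_0_iff) (use assms(2)[THEN less_imp_le] in \<open>auto intro!: mult_nonneg_nonneg\<close>)
      then have "(cmod ((ctrans U *v x) $ i))\<^sup>2 = 0" for i
        using assms(2)[of i] by (metis less_irrefl mult_eq_0_iff)
      then have "x \<bullet> x = 0"
        unfolding spectral_quadratic(2)[OF assms(1)] by simp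
      then show False using \<open>x \<noteq> 0\<close> by simp
    qed
  qed
  then show "0 < x \<bullet> (A *v x)" by simp
qed

lemma posdef_matfun:
  assumes "self_adjoint A" "\<And>x. f x > 0"
  shows "posdef (matfun f A)"
proof -
  obtain U l where "spectral_decomp U l A" using spectral_theorem[OF assms(1)] .
  from matfun_spectral[OF this, of f] show ?thesis
    using assms(2) by (intro posdefI) auto
qed

text \<open>The conditional premise covers two uses at once: a comparison valid on the whole line,
  and one valid only on the positive axis when \<open>A\<close> is positive definite, such as
  \<open>ln x \<le> x - 1\<close>.\<close>

lemma matfun_mono:
  assumes "self_adjoint A" "\<And>x. (posdef A \<longrightarrow> x > 0) \<Longrightarrow> f x \<le> g x"
  shows "loewner_le (matfun f A) (matfun g A)"
proof -
  obtain U l where sd: "spectral_decomp U l A" using spectral_theorem[OF assms(1)] .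
  show ?thesis
    using assms(2) posdef_spectral_pos[OF _ sd]
    by (auto simp: loewner_le_def spectral_quadratic(1)[OF matfun_spectral[OF sd]]
        intro!: sum_mono mult_right_mono)
qed

text \<open>In an eigenbasis of \<open>T\<close> the trace is a combination, with positive
  coefficients, of values of the quadratic form of the other factor.\<close>

lemma retrace_mult_mono:
  assumes "posdef T" "loewner_le A B"
  shows "retrace (T ** A) \<le> retrace (T ** B)"
proof -
  obtain U t where sd: "spectral_decomp U t T"
    using spectral_theorem assms(1) by (auto simp: posdef_def)
  show ?thesis
    unfolding trace_spectral_mult[OF sd]
    using assms(2) posdef_spectral_pos[OF assms(1) sd, THEN less_imp_le]
    by (auto simp: conj_nth_quadratic loewner_le_def intro!: sum_mono mult_left_mono)
qed

lemma retrace_mult_add: 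
  fixes T A B :: "complex^'n^'n"
  shows "retrace (T ** (A + B)) = retrace (T ** A) + retrace (T ** B)"
  by (simp add: matrix_add_ldistrib trace_add)

section \<open>Gibbs principle and monotonicity of the trace exponential\<close>

lemma trace_mult_matfun_self:
  assumes "spectral_decomp U t T"
  shows "retrace (T ** matfun f T) = (\<Sum>i\<in>UNIV. t i * f (t i))"
  using trace_spectral[OF spectral_decomp_mult[OF assms matfun_spectral[OF assms, of f]]] by simp

text \<open>The Gibbs variational principle: equality holds for \<open>T = exp H\<close>.\<close>

lemma gibbs_le:
  assumes "posdef T" "self_adjoint H"
  shows "retrace (T ** H) - retrace (T ** matfun ln T) + retrace T \<le> retrace (matfun exp H)"
proof -
  obtain U t where U: "spectral_decomp U t T"
    using spectral_theorem assms(1) by (auto simp: posdef_def)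
  obtain V h where V: "spectral_decomp V h H"
    using spectral_theorem[OF assms(2)] .
  define w where "w i j = (cmod ((ctrans U ** V) $ i $ j))\<^sup>2" for i j
  have W: "unitary_mat U" "unitary_mat V"
    using U V by (auto simp: spectral_decomp_def)
  have pos: "t i > 0" for i
    using posdef_spectral_pos[OF assms(1) U] .
  have "retrace (T ** H) - retrace (T ** matfun ln T) + retrace T
      = (\<Sum>i\<in>UNIV. \<Sum>j\<in>UNIV. w i j * (t i * h j)) - (\<Sum>i\<in>UNIV. t i * ln (t i)) + (\<Sum>i\<in>UNIV. t i)"
    using trace_mult_matfun_self[OF U, of ln] trace_spectral[OF U]
    by (simp add: retrace_spectral_mult2[OF U V] w_def)
  also have "\<dots> = (\<Sum>i\<in>UNIV. \<Sum>j\<in>UNIV. w i j * (t i * h j - t i * ln (t i) + t i))"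
    using unitary_weights(1)[OF W, of "\<lambda>i. t i * ln (t i)"] unitary_weights(1)[OF W, of t]
    by (simp add: w_def[symmetric] distrib_left right_diff_distrib sum.distrib sum_subtractf)
  also have "\<dots> \<le> (\<Sum>i\<in>UNIV. \<Sum>j\<in>UNIV. w i j * exp (h j))"
  proof (intro sum_mono mult_left_mono)
    fix i j
    \<comment> \<open>The scalar Gibbs inequality \<open>t * h - t * ln t + t \<le> exp h\<close>,
      which is \<open>1 + u \<le> exp u\<close> at \<open>u = h - ln t\<close> multiplied by
      \<open>t\<close>.\<close>
    have "t i * (1 + (h j - ln (t i))) \<le> t i * exp (h j - ln (t i))"
      using pos[of i] by (intro mult_left_mono exp_ge_add_one_self) auto
    also have "\<dots> = exp (h j)"
      using pos[of i] by (simp add: exp_diff)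
    finally show "t i * h j - t i * ln (t i) + t i \<le> exp (h j)"
      by (simp add: algebra_simps)
  qed (simp add: w_def)
  also have "\<dots> = retrace (matfun exp H)"
    using trace_spectral[OF matfun_spectral[OF V, of exp]] unitary_weights(2)[OF W, of "\<lambda>j. exp (h j)"]
    by (simp add: w_def)
  finally show ?thesis .
qed

lemma gibbs_eq:
  assumes "self_adjoint H"
  defines "T \<equiv> matfun exp H"
  shows "posdef T" "retrace (T ** H) - retrace (T ** matfun ln T) + retrace T = retrace (matfun exp H)"
proof -
  show "posdef T"
    unfolding T_def by (intro posdef_matfun assms) simp
  have "matfun ln T = H"
    unfolding T_def using assms(1) by (simp add: matfun_matfun matfun_ident)
  then show "retrace (T ** H) - retrace (T ** matfun ln T) + retrace T = retrace (matfun exp H)"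
    by (simp add: T_def)
qed

text \<open>The matrix exponential itself is not monotone in the Loewner order, but its trace is:
  the Gibbs optimiser for \<open>A\<close> is a competitor for \<open>B\<close>, and the variational
  expression is monotone in the exponent for a fixed competitor.\<close>

lemma retrace_exp_mono:
  assumes "self_adjoint A" "self_adjoint B" "loewner_le A B"
  shows "retrace (matfun exp A) \<le> retrace (matfun exp B)"
  using gibbs_eq[OF assms(1)] gibbs_le[OF gibbs_eq(1)[OF assms(1)] assms(2)]
    retrace_mult_mono[OF gibbs_eq(1)[OF assms(1)] assms(3)]
  by linarith

subsection \<open>Joint convexity of the relative entropy\<close>

text \<open>Umegaki's relative entropy, with the two linear trace terms that suit unnormalised
  matrices: each pair of eigenvalues then contributes the Taylor remainder
  \<open>s * ln s - s * ln z - s + z\<close>.\<close>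

definition relent :: "complex^'n^'n \<Rightarrow> complex^'n^'n \<Rightarrow> real" where
  "relent T X = retrace (T ** matfun ln T) - retrace (T ** matfun ln X) - retrace T + retrace X"

text \<open>Taylor's formula with integral remainder for \<open>s \<mapsto> s * ln (s / z) - s + z\<close> at \<open>z\<close>.\<close>

lemma scalar_relent_integral:
  fixes s z :: real
  assumes "s > 0" "z > 0"
  shows "((\<lambda>r. (1 - r) * ((s - z)\<^sup>2 / ((1 - r) * z + r * s))) has_integral
           (s * ln s - s * ln z - s + z)) {0..1}"
proof -
  define m where "m r = (1 - r) * z + r * s" for r
  have pos: "m r > 0" if "r \<in> {0..1}" for r
  proof (cases "r = 0")
    case False
    then have "r * s > 0" "(1 - r) * z \<ge> 0" using that assms by auto
    then show ?thesis by (simp add: m_def)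
  qed (use assms in \<open>simp add: m_def\<close>)
  have "((\<lambda>r. (1 - r) * ((s - z)\<^sup>2 / m r)) has_integral (s * ln (m 1) - m 1) - (s * ln (m 0) - m 0)) {0..1}"
  proof (rule fundamental_theorem_of_calculus)
    fix r :: real assume r: "r \<in> {0..1}"
    have "((\<lambda>r. s * ln (m r) - m r) has_real_derivative (1 - r) * ((s - z)\<^sup>2 / m r)) (at r within {0..1})"
    proof -
      have m': "(m has_real_derivative (s - z)) (at r within {0..1})"
        unfolding m_def by (auto intro!: derivative_eq_intros)
      have "((\<lambda>r. s * ln (m r) - m r) has_real_derivative s * ((s - z) / m r) - (s - z)) (at r within {0..1})"
        using pos[OF r] by (auto intro!: derivative_eq_intros m')
      moreover have "s * ((s - z) / m r) - (s - z) = (1 - r) * ((s - z)\<^sup>2 / m r)"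
      proof -
        have "s - m r = (1 - r) * (s - z)"
          by (simp add: m_def algebra_simps)
        then have "(s - m r) * (s - z) / m r = (1 - r) * (s - z) * (s - z) / m r"
          by simp
        then show ?thesis
          using pos[OF r] by (simp add: field_simps power2_eq_square)
      qed
      ultimately show ?thesis by simp
    qed
    then show "((\<lambda>r. s * ln (m r) - m r) has_vector_derivative (1 - r) * ((s - z)\<^sup>2 / m r)) (at r within {0..1})"
      by (simp add: has_real_derivative_iff_has_vector_derivative)
  qed simp
  moreover have eq: "(s * ln (m 1) - m 1) - (s * ln (m 0) - m 0) = s * ln s - s * ln z - s + z"
    by (simp add: m_def)
  ultimately show ?thesis unfolding eq unfolding m_def by blast
qed

text \<open>With <A, B> the real part of the trace of \<open>ctrans A ** B\<close>, this is 2 <B, T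
  - X> - <B, P B> for P B = (1 - r) X B + r B T. Its maximum over \<open>B\<close> is <T - X, P^{-1}
  (T - X)>, while for fixed \<open>B\<close> it is linear in the pair \<open>(T, X)\<close>.\<close>

definition minorant :: "real \<Rightarrow> complex^'n^'n \<Rightarrow> complex^'n^'n \<Rightarrow> complex^'n^'n \<Rightarrow> real" where
  "minorant r B T X = 2 * retrace (ctrans B ** (T - X))
     - (1 - r) * retrace (ctrans B ** X ** B) - r * retrace (B ** T ** ctrans B)"

lemma trace_ctrans_mult: "trace (ctrans C ** D) = (\<Sum>j\<in>UNIV. \<Sum>i\<in>UNIV. cnj (C $ j $ i) * D $ j $ i)"
  unfolding trace_def matrix_matrix_mult_def ctrans_def
  by (simp, rule sum.swap)

lemma trace_conj_unitary:
  assumes "unitary_mat U"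
  shows "trace (U ** A ** ctrans U) = trace A"
proof -
  have "trace (U ** (A ** ctrans U)) = trace (A ** ctrans U ** U)"
    by (rule trace_mul_sym)
  then show ?thesis
    using assms by (simp add: matrix_mul_assoc) (simp add: matrix_mul_assoc[symmetric] unitary_matD)
qed

text \<open>Rows are taken in the eigenbasis of \<open>X\<close> and columns in that of
  \<open>T\<close>. In these coordinates left multiplication by \<open>X\<close> and right
  multiplication by \<open>T\<close> are both diagonal, so the quadratic form decouples into one
  scalar problem per entry of \<open>C\<close>.\<close>

lemma minorant_expand:
  fixes T X C :: "complex^'n^'n"
  assumes T: "spectral_decomp U t T" and X: "spectral_decomp V x X"
  defines "Q \<equiv> ctrans V ** U"
  shows "minorant r (V ** C ** ctrans U) T X = (\<Sum>j\<in>UNIV. \<Sum>i\<in>UNIV.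
     2 * (t i - x j) * Re (cnj (C $ j $ i) * Q $ j $ i) - ((1 - r) * x j + r * t i) * (cmod (C $ j $ i))\<^sup>2)"
proof -
  have U: "unitary_mat U" and Teq: "T = U ** diag_mat t ** ctrans U"
    and V: "unitary_mat V" and Xeq: "X = V ** diag_mat x ** ctrans V"
    using T X by (auto simp: spectral_decomp_def)
  have sq: "Re (cnj z * (c * z)) = c * (cmod z)\<^sup>2" for z and c :: real
    by (simp add: cmod_power2) (simp add: power2_eq_square algebra_simps)
  have 1: "ctrans (V ** C ** ctrans U) ** T = U ** (ctrans C ** (Q ** diag_mat t)) ** ctrans U"
    by (simp add: Teq Q_def ctrans_mult matrix_mul_assoc)
  have 2: "ctrans (V ** C ** ctrans U) ** X = U ** (ctrans C ** (diag_mat x ** Q)) ** ctrans U"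
    unfolding Xeq Q_def ctrans_mult ctrans_ctrans
    by (simp add: matrix_mul_assoc) (simp add: matrix_mul_assoc[symmetric] unitary_matD[OF V] unitary_matD[OF U])
  have 3: "ctrans (V ** C ** ctrans U) ** X ** (V ** C ** ctrans U) = U ** (ctrans C ** (diag_mat x ** C)) ** ctrans U"
  proof -
    have "Q ** ctrans U ** V = ctrans V ** (U ** ctrans U) ** V"
      by (simp only: Q_def matrix_mul_assoc)
    then have QU: "Q ** ctrans U ** V = mat 1"
      by (simp add: unitary_matD[OF U] unitary_matD[OF V])
    have "U ** (ctrans C ** (diag_mat x ** Q)) ** ctrans U ** (V ** C ** ctrans U)
        = U ** (ctrans C ** (diag_mat x ** ((Q ** ctrans U ** V) ** C))) ** ctrans U"
      by (simp only: matrix_mul_assoc)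
    then show ?thesis unfolding 2 QU by simp
  qed
  have 4: "(V ** C ** ctrans U) ** T ** ctrans (V ** C ** ctrans U) = V ** (C ** diag_mat t ** ctrans C) ** ctrans V"
  proof -
    have "(V ** C ** ctrans U) ** T ** ctrans (V ** C ** ctrans U)
        = V ** (C ** (ctrans U ** U) ** diag_mat t ** (ctrans U ** U) ** ctrans C) ** ctrans V"
      by (simp only: Teq ctrans_mult ctrans_ctrans matrix_mul_assoc)
    then show ?thesis by (simp add: unitary_matD[OF U])
  qed
  have e1: "trace (ctrans (V ** C ** ctrans U) ** T)
      = (\<Sum>j\<in>UNIV. \<Sum>i\<in>UNIV. cnj (C $ j $ i) * (Q $ j $ i * t i))"
    unfolding 1 trace_conj_unitary[OF U] by (simp add: trace_ctrans_mult diag_mat_mult_right)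
  have e2: "trace (ctrans (V ** C ** ctrans U) ** X)
      = (\<Sum>j\<in>UNIV. \<Sum>i\<in>UNIV. cnj (C $ j $ i) * (x j * Q $ j $ i))"
    unfolding 2 trace_conj_unitary[OF U] by (simp add: trace_ctrans_mult diag_mat_mult_left)
  have e3: "trace (ctrans (V ** C ** ctrans U) ** X ** (V ** C ** ctrans U))
      = (\<Sum>j\<in>UNIV. \<Sum>i\<in>UNIV. cnj (C $ j $ i) * (x j * C $ j $ i))"
    unfolding 3 trace_conj_unitary[OF U] by (simp add: trace_ctrans_mult diag_mat_mult_left)
  have e4: "trace ((V ** C ** ctrans U) ** T ** ctrans (V ** C ** ctrans U))
      = (\<Sum>j\<in>UNIV. \<Sum>i\<in>UNIV. cnj (C $ j $ i) * (t i * C $ j $ i))"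
    unfolding 4 trace_conj_unitary[OF V] trace_mul_sym[of _ "ctrans C"]
    by (simp add: trace_ctrans_mult diag_mat_mult_right mult_ac)
  have d: "ctrans B ** (T - X) = ctrans B ** T - ctrans B ** X" for B
    by (simp add: vec_eq_iff matrix_matrix_mult_def right_diff_distrib sum_subtractf)
  have q: "Re (cnj c * (q * of_real a)) = a * Re (cnj c * q)" "Re (cnj c * (of_real a * q)) = a * Re (cnj c * q)"
    for c q :: complex and a
    by (simp_all add: algebra_simps)
  show ?thesis
    unfolding minorant_def d trace_sub e1 e2 e3 e4 minus_complex.simps Re_sum sq q
    unfolding sum_distrib_left sum_subtractf[symmetric]
    by (intro sum.cong refl, simp add: cmod_power2, simp add: algebra_simps power2_eq_square)
qed

text \<open>Completing the square in each entry of \<open>ctrans V ** B ** U\<close>. The second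
  claim is the equality case, where all completed squares vanish.\<close>

lemma minorant_le:
  assumes T: "spectral_decomp U t T" "posdef T" and X: "spectral_decomp V x X" "posdef X" and r: "r \<in> {0..1}"
  shows "minorant r B T X \<le> (\<Sum>j\<in>UNIV. \<Sum>i\<in>UNIV.
     (cmod ((ctrans V ** U) $ j $ i))\<^sup>2 * ((t i - x j)\<^sup>2 / ((1 - r) * x j + r * t i)))" (is ?le)
    and "\<forall>j i. (ctrans V ** B ** U) $ j $ i = of_real ((t i - x j) / ((1 - r) * x j + r * t i)) * (ctrans V ** U) $ j $ i \<Longrightarrow>
     minorant r B T X = (\<Sum>j\<in>UNIV. \<Sum>i\<in>UNIV.
     (cmod ((ctrans V ** U) $ j $ i))\<^sup>2 * ((t i - x j)\<^sup>2 / ((1 - r) * x j + r * t i)))" (is "?H \<Longrightarrow> ?eq")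
proof -
  define C where "C = ctrans V ** B ** U"
  define Q where "Q = ctrans V ** U"
  define m where "m j i = (1 - r) * x j + r * t i" for j i
  have UV: "unitary_mat U" "unitary_mat V"
    using T X by (auto simp: spectral_decomp_def)
  have B: "B = V ** C ** ctrans U"
    unfolding C_def
    by (simp add: matrix_mul_assoc unitary_matD[OF UV(2)]) (simp add: matrix_mul_assoc[symmetric] unitary_matD[OF UV(1)])
  have pos: "m j i > 0" for j i
  proof (cases "r = 0")
    case False
    then have "r * t i > 0" "(1 - r) * x j \<ge> 0"
      using r posdef_spectral_pos[OF T(2,1), of i] posdef_spectral_pos[OF X(2,1), of j] by auto
    then show ?thesis by (simp add: m_def)
  qed (use posdef_spectral_pos[OF X(2,1), of j] in \<open>simp add: m_def\<close>)
  have ex: "minorant r B T X = (\<Sum>j\<in>UNIV. \<Sum>i\<in>UNIV.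
     2 * (t i - x j) * Re (cnj (C $ j $ i) * Q $ j $ i) - m j i * (cmod (C $ j $ i))\<^sup>2)"
    unfolding B Q_def m_def by (rule minorant_expand[OF T(1) X(1)])
  have sq: "2 * a * Re (cnj c * q) - m * (cmod c)\<^sup>2
      = (cmod q)\<^sup>2 * (a\<^sup>2 / m) - m * (cmod (c - of_real (a / m) * q))\<^sup>2" if "m > 0" for a m :: real and c q
  proof -
    define k where "k = a / m"
    have a: "a = k * m" using that by (simp add: k_def)
    have km: "(k * m)\<^sup>2 / m = k\<^sup>2 * m" "k * m / m = k"
      using that by (simp_all add: power2_eq_square)
    show ?thesis
      unfolding a km
      by (simp add: cmod_power2) (simp add: power2_eq_square algebra_simps)
  qed
  show ?le
    unfolding ex Q_def[symmetric] m_def[symmetric]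
  proof (intro sum_mono)
    fix j i
    have "0 \<le> m j i * (cmod (C $ j $ i - of_real ((t i - x j) / m j i) * Q $ j $ i))\<^sup>2"
      using pos[of j i] by simp
    then show "2 * (t i - x j) * Re (cnj (C $ j $ i) * Q $ j $ i) - m j i * (cmod (C $ j $ i))\<^sup>2
      \<le> (cmod (Q $ j $ i))\<^sup>2 * ((t i - x j)\<^sup>2 / m j i)"
      unfolding sq[OF pos[of j i]] by linarith
  qed
  assume ?H
  then have H: "C $ j $ i = of_real ((t i - x j) / m j i) * Q $ j $ i" for j i
    by (simp add: C_def m_def Q_def)
  show ?eq
    unfolding ex Q_def[symmetric] m_def[symmetric]
    by (intro sum.cong refl, subst sq[OF pos]) (simp add: H)
qed

text \<open>The scalar Taylor formula is applied to each pair \<open>(t i, x j)\<close> and averaged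
  with the overlap weights; their row and column sums recover the traces that involve only one of
  the matrices.\<close>

lemma relent_has_integral:
  assumes T: "spectral_decomp U t T" "posdef T" and X: "spectral_decomp V x X" "posdef X"
  shows "((\<lambda>r. (1 - r) * (\<Sum>j\<in>UNIV. \<Sum>i\<in>UNIV. (cmod ((ctrans V ** U) $ j $ i))\<^sup>2 *
     ((t i - x j)\<^sup>2 / ((1 - r) * x j + r * t i)))) has_integral relent T X) {0..1}"
proof -
  define w where "w j i = (cmod ((ctrans V ** U) $ j $ i))\<^sup>2" for j i
  have UV: "unitary_mat U" "unitary_mat V"
    using T X by (auto simp: spectral_decomp_def)
  have w': "(cmod ((ctrans U ** V) $ i $ j))\<^sup>2 = w j i" for i j
  proof -
    have "ctrans U ** V = ctrans (ctrans V ** U)"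
      by (simp add: ctrans_mult)
    then show ?thesis by (simp add: w_def ctrans_nth)
  qed
  have "retrace (T ** matfun ln X) = (\<Sum>i\<in>UNIV. \<Sum>j\<in>UNIV. w j i * (t i * ln (x j)))"
    using retrace_spectral_mult2[OF T(1) matfun_spectral[OF X(1), of ln]] by (simp add: w')
  also have "\<dots> = (\<Sum>j\<in>UNIV. \<Sum>i\<in>UNIV. w j i * (t i * ln (x j)))"
    by (rule sum.swap)
  finally have "relent T X = (\<Sum>j\<in>UNIV. \<Sum>i\<in>UNIV. w j i * (t i * ln (t i) - t i * ln (x j) - t i + x j))"
    unfolding relent_def trace_mult_matfun_self[OF T(1)] trace_spectral[OF T(1)] trace_spectral[OF X(1)]
    using unitary_weights(1)[OF UV(2,1), of x] unitary_weights(2)[OF UV(2,1), of t]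
      unitary_weights(2)[OF UV(2,1), of "\<lambda>i. t i * ln (t i)"]
    by (simp add: w_def[symmetric] distrib_left right_diff_distrib sum.distrib sum_subtractf)
  moreover have "((\<lambda>r. \<Sum>j\<in>UNIV. \<Sum>i\<in>UNIV. w j i * ((1 - r) * ((t i - x j)\<^sup>2 / ((1 - r) * x j + r * t i)))) has_integral
      (\<Sum>j\<in>UNIV. \<Sum>i\<in>UNIV. w j i * (t i * ln (t i) - t i * ln (x j) - t i + x j))) {0..1}"
    by (intro has_integral_sum has_integral_mult_right scalar_relent_integral
        posdef_spectral_pos[OF T(2,1)] posdef_spectral_pos[OF X(2,1)]) auto
  moreover have "(\<lambda>r. \<Sum>j\<in>UNIV. \<Sum>i\<in>UNIV. w j i * ((1 - r) * ((t i - x j)\<^sup>2 / ((1 - r) * x j + r * t i))))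
    = (\<lambda>r. (1 - r) * (\<Sum>j\<in>UNIV. \<Sum>i\<in>UNIV. w j i * ((t i - x j)\<^sup>2 / ((1 - r) * x j + r * t i))))"
    by (simp add: sum_distrib_left mult_ac)
  ultimately show ?thesis by (simp add: w_def)
qed

lemma continuous_on_matrix_mult [continuous_intros]:
  fixes f g :: "'a :: topological_space \<Rightarrow> complex^'n^'n"
  shows "continuous_on S f \<Longrightarrow> continuous_on S g \<Longrightarrow> continuous_on S (\<lambda>x. f x ** g x)"
  unfolding matrix_matrix_mult_def by (intro continuous_intros) 

lemma continuous_on_ctrans [continuous_intros]:
  fixes f :: "'a :: topological_space \<Rightarrow> complex^'n^'n"
  shows "continuous_on S f \<Longrightarrow> continuous_on S (\<lambda>x. ctrans (f x))"
  unfolding ctrans_def by (intro continuous_intros) 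

lemma continuous_on_trace [continuous_intros]:
  fixes f :: "'a :: topological_space \<Rightarrow> complex^'n^'n"
  shows "continuous_on S f \<Longrightarrow> continuous_on S (\<lambda>x. trace (f x))"
  unfolding trace_def by (intro continuous_intros) 

text \<open>Linearity in the pair is split into one functional of \<open>T\<close> and one of
  \<open>X\<close>, the form in which expectations are later moved inside.\<close>

lemma minorant_linear:
  fixes T X :: "complex^'n^'n"
  shows "minorant r B T X = minorant r B T 0 + minorant r B 0 X"
    "linear (\<lambda>T :: complex^'n^'n. minorant r B T 0)" "linear (\<lambda>X :: complex^'n^'n. minorant r B 0 X)"
proof -
  have z: "A ** 0 = 0" "0 ** A = 0" for A :: "complex^'n^'n"
    by (simp_all add: vec_eq_iff matrix_matrix_mult_def)
  have d: "A ** (C - D) = A ** C - A ** D" for A C D :: "complex^'n^'n"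
    by (simp add: vec_eq_iff matrix_matrix_mult_def right_diff_distrib sum_subtractf)
  have s: "retrace (c *\<^sub>R A) = c * retrace A" for c and A :: "complex^'n^'n"
    using linear_cmul[OF linear_retrace] by simp
  have n: "A ** (- C) = - (A ** C)" for A C :: "complex^'n^'n"
    by (simp add: vec_eq_iff matrix_matrix_mult_def sum_negf)
  have n': "retrace (- A) = - retrace A" for A :: "complex^'n^'n"
    by (rule linear_neg[OF linear_retrace])
  have t0: "trace (0 :: complex^'n^'n) = 0"
    by (simp add: trace_def)
  note simps = minorant_def z d s n n' t0 trace_add trace_sub matrix_add_ldistrib matrix_add_mult_rdistrib matrix_mult_scaleR
  show "minorant r B T X = minorant r B T 0 + minorant r B 0 X"
    by (simp add: simps)
  show "linear (\<lambda>T :: complex^'n^'n. minorant r B T 0)" "linear (\<lambda>X :: complex^'n^'n. minorant r B 0 X)"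
    by (rule linearI; simp add: simps algebra_simps)+
qed

text \<open>For fixed \<open>r\<close> the integrand of \<^term>\<open>relent\<close> is a supremum of linear functions of the pair
  \<open>(T, X)\<close>, attained at a matrix \<open>B\<close> depending continuously on \<open>r\<close>; integrating the minorant which
  is optimal at \<open>(S, Z)\<close> gives a supporting linear functional there.\<close>

lemma relent_tangent:
  fixes S Z :: "complex^'n^'n"
  assumes "posdef S" "posdef Z"
  obtains f g :: "complex^'n^'n \<Rightarrow> real" where "linear f" "linear g" "f S + g Z = relent S Z"
    "\<And>T X. posdef T \<Longrightarrow> posdef X \<Longrightarrow> f T + g X \<le> relent T X"
proof -
  obtain U s where S: "spectral_decomp U s S"
    using spectral_theorem assms(1) by (auto simp: posdef_def)
  obtain V z where Z: "spectral_decomp V z Z"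
    using spectral_theorem assms(2) by (auto simp: posdef_def)
  have UV: "unitary_mat U" "unitary_mat V"
    using S Z by (auto simp: spectral_decomp_def)
  define m where "m r j i = (1 - r) * z j + r * s i" for r :: real and j i
  \<comment> \<open>The entries dictated by the equality case of \<open>minorant_le\<close> at
    \<open>(S, Z)\<close>.\<close>
  define C :: "real \<Rightarrow> complex^'n^'n" where
    "C r = (\<chi> j i. of_real ((s i - z j) / m r j i) * (ctrans V ** U) $ j $ i)" for r
  define B where "B r = V ** C r ** ctrans U" for r
  have pos: "m r j i > 0" if "r \<in> {0..1}" for r j i
  proof (cases "r = 0")
    case False
    then have "r * s i > 0" "(1 - r) * z j \<ge> 0"
      using that posdef_spectral_pos[OF assms(1) S, of i] posdef_spectral_pos[OF assms(2) Z, of j] by auto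
    then show ?thesis by (simp add: m_def)
  qed (use posdef_spectral_pos[OF assms(2) Z, of j] in \<open>simp add: m_def\<close>)
  \<comment> \<open>Continuity in \<open>r\<close> makes the minorant integrable for every pair
    \<open>(T, X)\<close>, not only at \<open>(S, Z)\<close>, so \<open>f\<close> and
    \<open>g\<close> are linear on the whole matrix space.\<close>
  have "continuous_on {0..1} C"
    unfolding C_def m_def
    by (intro continuous_intros) (use pos in \<open>auto simp: m_def less_imp_neq[THEN not_sym]\<close>)
  then have contB: "continuous_on {0..1} B"
    unfolding B_def by (intro continuous_intros)
  have integrable: "(\<lambda>r. (1 - r) * minorant r (B r) T X) integrable_on {0..1}" for T X
    unfolding minorant_def by (intro integrable_continuous_interval continuous_intros contB)
  define f where "f T = integral {0..1} (\<lambda>r. (1 - r) * minorant r (B r) T 0)" for T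
  define g where "g X = integral {0..1} (\<lambda>r. (1 - r) * minorant r (B r) 0 X)" for X
  have fg: "f T + g X = integral {0..1} (\<lambda>r. (1 - r) * minorant r (B r) T X)" for T X
    unfolding f_def g_def
    by (subst minorant_linear(1)) (simp add: distrib_left integral_add[OF integrable integrable])
  show ?thesis
  proof
    show "linear f" 
      unfolding f_def
      using integral_add[OF integrable integrable]
      by (intro linearI)
         (simp_all add: linear_add[OF minorant_linear(2)] linear_cmul[OF minorant_linear(2)] distrib_left
           mult.left_commute)
    show "linear g" 
      unfolding g_def
      using integral_add[OF integrable integrable]
      by (intro linearI)
         (simp_all add: linear_add[OF minorant_linear(3)] linear_cmul[OF minorant_linear(3)] distrib_left
           mult.left_commute)
    show "f T + g X \<le> relent T X" if TX: "posdef T" "posdef X" for T X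
    proof -
      obtain U' t where T: "spectral_decomp U' t T"
        using spectral_theorem TX(1) by (auto simp: posdef_def)
      obtain V' x where X: "spectral_decomp V' x X"
        using spectral_theorem TX(2) by (auto simp: posdef_def)
      show ?thesis
        unfolding fg
        by (rule has_integral_le[OF integrable_integral[OF integrable] relent_has_integral[OF T TX(1) X TX(2)]])
           (intro mult_left_mono minorant_le(1)[OF T TX(1) X TX(2)]; simp)
    qed
    have BC: "ctrans V ** B r ** U = C r" for r
      unfolding B_def
      by (simp add: matrix_mul_assoc unitary_matD[OF UV(2)]) (simp add: matrix_mul_assoc[symmetric] unitary_matD[OF UV(1)])
    have "f S + g Z = integral {0..1} (\<lambda>r. (1 - r) * (\<Sum>j\<in>UNIV. \<Sum>i\<in>UNIV. (cmod ((ctrans V ** U) $ j $ i))\<^sup>2 *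
     ((s i - z j)\<^sup>2 / ((1 - r) * z j + r * s i))))"
      unfolding fg
      by (intro integral_cong arg_cong2[where f = "(*)"] refl minorant_le(2)[OF S assms(1) Z assms(2)])
         (auto simp: BC C_def m_def)
    then show "f S + g Z = relent S Z"
      using integral_unique[OF relent_has_integral[OF S assms(1) Z assms(2)]] by simp
  qed
qed

subsection \<open>Norms and continuity\<close>

text \<open>The type's \<open>norm\<close> is the Frobenius norm, distinct from
  \<open>opnorm\<close>; its square is the trace of \<open>ctrans A ** A\<close>.\<close>

lemma norm_spectral:
  fixes A :: "complex^'n^'n"
  assumes "spectral_decomp U l A"
  shows "norm A = L2_set l UNIV"
proof -
  have "(norm A)\<^sup>2 = (\<Sum>i\<in>UNIV. \<Sum>j\<in>UNIV. (cmod (A $ i $ j))\<^sup>2)"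
    by (simp add: norm_vec_def L2_set_def sum_nonneg)
  also have "\<dots> = retrace (ctrans A ** A)"
    unfolding trace_ctrans_mult Re_sum by (simp add: cmod_power2) (simp add: power2_eq_square)
  also have "\<dots> = retrace (A ** A)"
    using self_adjoint_spectral[OF assms] by (simp add: self_adjoint_def)
  also have "\<dots> = (\<Sum>i\<in>UNIV. (l i)\<^sup>2)"
    using trace_spectral[OF spectral_decomp_mult[OF assms assms]] by (simp add: power2_eq_square)
  finally show ?thesis
    by (simp add: L2_set_def real_sqrt_unique)
qed

lemma norm_matfun_mono:
  assumes "self_adjoint A" "\<And>x. \<bar>f x\<bar> \<le> \<bar>g x\<bar>"
  shows "norm (matfun f A) \<le> norm (matfun g A)"
proof -
  obtain U l where sd: "spectral_decomp U l A" using spectral_theorem[OF assms(1)] .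
  show ?thesis
    using assms(2)
    by (auto simp: norm_spectral[OF matfun_spectral[OF sd]] L2_set_def abs_le_square_iff intro!: sum_mono)
qed

text \<open>The l2 norm of the positive eigenvalues is at most their l1 norm. This lets a trace
  bound dominate a matrix-valued integrand.\<close>

lemma norm_le_retrace:
  assumes "posdef T"
  shows "norm T \<le> retrace T"
proof -
  obtain U t where U: "spectral_decomp U t T"
    using spectral_theorem assms by (auto simp: posdef_def)
  show ?thesis
    unfolding norm_spectral[OF U] trace_spectral[OF U]
    using posdef_spectral_pos[OF assms U, THEN less_imp_le] by (auto intro!: L2_set_le_sum)
qed

lemma norm_unitary:
  fixes U :: "complex^'n^'n"
  assumes "unitary_mat U"
  shows "norm U = sqrt CARD('n)"
  using unitary_row_sum[OF assms] by (simp add: norm_vec_def L2_set_def sum_nonneg)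

lemma matrix_vector_add_left: "((A + B) *v x) = A *v x + B *v x" for A B :: "complex^'n^'n"
  by (simp add: vec_eq_iff matrix_vector_mult_def distrib_right sum.distrib)

lemma matrix_vector_scaleR_left: "((c *\<^sub>R A) *v x) = c *\<^sub>R (A *v x)" for A :: "complex^'n^'n"
  by (simp add: vec_eq_iff matrix_vector_mult_def scaleR_sum_right)

lemma loewner_le_norm:
  assumes "self_adjoint A"
  shows "loewner_le A (norm A *\<^sub>R mat 1)"
  unfolding loewner_le_def
proof
  fix x
  obtain U l where sd: "spectral_decomp U l A" using spectral_theorem[OF assms] .
  have "l i \<le> norm A" for i
    using member_le_L2_set[of UNIV i "\<lambda>i. \<bar>l i\<bar>"] norm_spectral[OF sd] by (simp add: L2_set_def)
  then have "x \<bullet> (A *v x) \<le> norm A * (x \<bullet> x)"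
    unfolding spectral_quadratic[OF sd] sum_distrib_left by (intro sum_mono mult_right_mono) auto
  then show "x \<bullet> (A *v x) \<le> x \<bullet> (norm A *\<^sub>R mat 1 *v x)"
    by (simp add: matrix_vector_scaleR_left)
qed

text \<open>Eigenvectors need not depend continuously on the matrix, so compactness is used instead.
  The pairs in \<open>C R\<close> form a compact set, the map \<open>p (\<lambda>x. x)\<close> sends
  it onto the self-adjoint matrices of norm at most \<open>R\<close>, and on it
  \<open>matfun f\<close> lifts to the continuous map \<open>p f\<close>. Preimages of closed sets
  are therefore images of compact sets, up to the norm bound.\<close>

lemma continuous_matfun:
  fixes f :: "real \<Rightarrow> real"
  assumes "continuous_on UNIV f"
  shows "continuous_on {A :: complex^'n^'n. self_adjoint A} (matfun f)"
proof -
  define p :: "(real \<Rightarrow> real) \<Rightarrow> (complex^'n^'n) \<times> (real^'n) \<Rightarrow> complex^'n^'n" where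
    "p g = (\<lambda>(U, l). U ** diag_mat (\<lambda>i. g (l $ i)) ** ctrans U)" for g
  define C :: "real \<Rightarrow> ((complex^'n^'n) \<times> (real^'n)) set" where
    "C R = {U. unitary_mat U} \<times> cball 0 R" for R
  have contp: "continuous_on UNIV (p g)" if "continuous_on UNIV g" for g
  proof -
    have "continuous_on UNIV (\<lambda>c :: (complex^'n^'n) \<times> (real^'n). g (snd c $ i))" for i
      by (rule continuous_on_compose2[OF that]) (auto intro!: continuous_intros)
    then have "continuous_on UNIV (\<lambda>c :: (complex^'n^'n) \<times> (real^'n).
        if i = j then complex_of_real (g (snd c $ i)) else 0)" for i j
      by (cases "i = j") (auto intro!: continuous_intros)
    then show ?thesis
      unfolding p_def case_prod_beta diag_mat_def by (intro continuous_intros)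
  qed
  have "closed {U :: complex^'n^'n. unitary_mat U}"
    unfolding unitary_mat_def by (intro closed_Collect_conj closed_Collect_eq continuous_intros)
  moreover have "bounded {U :: complex^'n^'n. unitary_mat U}"
    unfolding bounded_iff using norm_unitary by (metis mem_Collect_eq order_refl)
  ultimately have compC: "compact (C R)" for R
    unfolding C_def by (intro compact_Times compact_cball) (simp add: compact_eq_bounded_closed)
  have pC: "spectral_decomp (fst c) (($) (snd c)) (p (\<lambda>x. x) c)" if "c \<in> C R" for c R
    using that by (auto simp: C_def p_def spectral_decomp_def)
  have matfun_p: "matfun f (p (\<lambda>x. x) c) = p f c" if "c \<in> C R" for c R
    using matfun_spectral[OF pC[OF that], of f] by (simp add: spectral_decomp_def p_def case_prod_beta o_def)
  have surj: "\<exists>c\<in>C R. A = p (\<lambda>x. x) c" if sa: "self_adjoint A" and le: "norm A \<le> R" for A R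
  proof -
    obtain U l where sd: "spectral_decomp U l A" using spectral_theorem[OF sa] .
    have vec: "($) (vec_lambda l) = l" by (simp add: fun_eq_iff)
    have "(U, \<chi> i. l i) \<in> C R"
      using sd le norm_spectral[OF sd]
      by (auto simp: C_def spectral_decomp_def norm_vec_def L2_set_def)
    moreover have "A = p (\<lambda>x. x) (U, \<chi> i. l i)"
      using sd by (simp add: spectral_decomp_def p_def vec)
    ultimately show ?thesis by blast
  qed
  have clSA: "closed {A :: complex^'n^'n. self_adjoint A}"
    unfolding self_adjoint_def by (intro closed_Collect_eq continuous_intros)
  show ?thesis
    unfolding continuous_on_closed_vimage[OF clSA]
  proof (intro allI impI)
    fix B :: "(complex^'n^'n) set" assume B: "closed B"
    have closed_part: "closed (p (\<lambda>x. x) ` (p f -` B \<inter> C R))" for R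
      by (intro compact_imp_closed compact_continuous_image continuous_on_subset[OF contp] compact_Int
          closed_Int_compact closed_vimage B compC contp assms) auto
    have part: "p (\<lambda>x. x) ` (p f -` B \<inter> C R) \<subseteq> matfun f -` B \<inter> {A. self_adjoint A}" for R
    proof clarify
      fix c assume c: "c \<in> C R" "p f c \<in> B"
      show "p (\<lambda>x. x) c \<in> matfun f -` B \<inter> {A. self_adjoint A}"
        using c self_adjoint_spectral[OF pC[OF c(1)]] by (simp add: matfun_p[OF c(1)])
    qed
    \<comment> \<open>A convergent sequence is bounded, which supplies one \<open>R\<close> for all
      its terms and puts the whole sequence into a single closed part.\<close>
    show "closed (matfun f -` B \<inter> {A. self_adjoint A})"
      unfolding closed_sequential_limits
    proof (intro allI impI, elim conjE)
      fix A :: "nat \<Rightarrow> complex^'n^'n" and L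
      assume A: "\<forall>n. A n \<in> matfun f -` B \<inter> {A. self_adjoint A}" and lim: "A \<longlonglongrightarrow> L"
      obtain R where R: "norm (A n) \<le> R" for n
        using convergent_imp_bounded[OF lim] by (auto simp: bounded_iff)
      have "A n \<in> p (\<lambda>x. x) ` (p f -` B \<inter> C R)" for n
      proof -
        obtain c where c: "c \<in> C R" "A n = p (\<lambda>x. x) c"
          using surj[of "A n" R] A R by auto
        then have "p f c \<in> B"
          using matfun_p[OF c(1)] A by (metis IntD1 vimageE)
        then show ?thesis using c by auto
      qed
      then have "L \<in> p (\<lambda>x. x) ` (p f -` B \<inter> C R)"
        using closed_part[of R] lim unfolding closed_sequential_limits by blast
      then show "L \<in> matfun f -` B \<inter> {A. self_adjoint A}"
        using part by blast
    qed
  qed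
qed

text \<open>A continuous retraction onto the self-adjoint matrices. Composing
  \<open>matfun f\<close> with it gives a map that is continuous, hence Borel, on the whole matrix
  space and agrees with \<open>matfun f\<close> where it matters.\<close>

definition hermitian_part :: "complex^'n^'n \<Rightarrow> complex^'n^'n" where
  "hermitian_part A = (1/2) *\<^sub>R (A + ctrans A)"

lemma hermitian_part_self_adjoint: "self_adjoint A \<Longrightarrow> hermitian_part A = A"
  by (simp add: hermitian_part_def self_adjoint_def flip: scaleR_2)

lemma self_adjoint_hermitian_part: "self_adjoint (hermitian_part A)"
  by (simp add: hermitian_part_def self_adjoint_def ctrans_add ctrans_scaleR add.commute)

lemma continuous_matfun_hermitian:
  fixes f :: "real \<Rightarrow> real"
  assumes "continuous_on UNIV f"
  shows "continuous_on UNIV (\<lambda>A :: complex^'n^'n. matfun f (hermitian_part A))"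
proof (rule continuous_on_compose2[OF continuous_matfun[OF assms]])
  show "continuous_on UNIV (hermitian_part :: complex^'n^'n \<Rightarrow> complex^'n^'n)"
    unfolding hermitian_part_def by (intro continuous_intros)
qed (auto simp: self_adjoint_hermitian_part)

lemma measurable_matfun_hermitian:
  assumes "continuous_on UNIV f"
  shows "(\<lambda>A :: complex^'n^'n. matfun f (hermitian_part A)) \<in> borel_measurable borel"
  by (intro borel_measurable_continuous_onI continuous_matfun_hermitian assms)

lemma measurable_matfun:
  fixes W :: "'a \<Rightarrow> complex^'n^'n"
  assumes "W \<in> borel_measurable M" "\<And>\<omega>. \<omega> \<in> space M \<Longrightarrow> self_adjoint (W \<omega>)" "continuous_on UNIV f"
  shows "(\<lambda>\<omega>. matfun f (W \<omega>)) \<in> borel_measurable M"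
proof -
  have "(\<lambda>\<omega>. matfun f (hermitian_part (W \<omega>))) \<in> borel_measurable M"
    by (rule measurable_compose[OF assms(1) measurable_matfun_hermitian[OF assms(3)]])
  then show ?thesis
    by (rule measurable_cong[THEN iffD1, rotated]) (simp add: hermitian_part_self_adjoint assms(2))
qed

lemma measurable_retrace [measurable]:
  "(retrace :: complex^'n^'n \<Rightarrow> real) \<in> borel_measurable borel"
  by (intro borel_measurable_continuous_onI continuous_intros)

lemma retrace_matfun_exp_nonneg:
  "self_adjoint A \<Longrightarrow> 0 \<le> retrace (matfun exp A)"
  using norm_le_retrace[OF gibbs_eq(1), of A] norm_ge_zero order_trans by blast

section \<open>Calculus of the Loewner order\<close>

lemma linear_quadratic: "linear (\<lambda>A :: complex^'n^'n. x \<bullet> (A *v x))"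
  by (rule linearI) (simp_all add: matrix_vector_add_left matrix_vector_scaleR_left inner_add_right)

lemma loewner_le_refl: "loewner_le A A"
  by (simp add: loewner_le_def)

lemma loewner_le_add: "loewner_le A B \<Longrightarrow> loewner_le C D \<Longrightarrow> loewner_le (A + C) (B + D)"
  by (auto simp: loewner_le_def matrix_vector_add_left inner_add_right intro: add_mono)

lemma loewner_le_trans: "loewner_le A B \<Longrightarrow> loewner_le B C \<Longrightarrow> loewner_le A C"
  by (auto simp: loewner_le_def intro: order_trans)

lemma loewner_le_scaleR: "loewner_le A B \<Longrightarrow> 0 \<le> c \<Longrightarrow> loewner_le (c *\<^sub>R A) (c *\<^sub>R B)"
  by (auto simp: loewner_le_def matrix_vector_scaleR_left intro: mult_left_mono)

lemma loewner_le_sum: "(\<And>i. i \<in> I \<Longrightarrow> loewner_le (A i) (B i)) \<Longrightarrow> loewner_le (\<Sum>i\<in>I. A i) (\<Sum>i\<in>I. B i)"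
  by (induction I rule: infinite_finite_induct) (auto simp: loewner_le_refl loewner_le_add)

subsection \<open>Expectations\<close>

lemma integral_linear_fun:
  fixes f :: "'b :: euclidean_space \<Rightarrow> 'c :: euclidean_space"
  assumes "linear f" "integrable M X"
  shows "integrable M (\<lambda>\<omega>. f (X \<omega>))" "integral\<^sup>L M (\<lambda>\<omega>. f (X \<omega>)) = f (integral\<^sup>L M X)"
  using assms integrable_bounded_linear[of f M X] integral_bounded_linear[of f M X]
  by (auto simp: linear_conv_bounded_linear)

lemma self_adjoint_integral:
  fixes X :: "'a \<Rightarrow> complex^'n^'n"
  assumes "integrable M X" "\<And>\<omega>. \<omega> \<in> space M \<Longrightarrow> self_adjoint (X \<omega>)"
  shows "self_adjoint (integral\<^sup>L M X)"
proof -
  have "ctrans (integral\<^sup>L M X) = integral\<^sup>L M (\<lambda>\<omega>. ctrans (X \<omega>))"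
    by (rule integral_linear_fun(2)[OF linear_ctrans assms(1), symmetric])
  also have "\<dots> = integral\<^sup>L M X"
    using assms(2) by (intro Bochner_Integration.integral_cong) (auto simp: self_adjoint_def)
  finally show ?thesis by (simp add: self_adjoint_def)
qed

text \<open>Strict positivity survives integration: a nonnegative function with zero integral
  vanishes almost everywhere, which is impossible for a positive one on a probability space.\<close>

lemma (in prob_space) posdef_integral:
  fixes X :: "'a \<Rightarrow> complex^'n^'n"
  assumes int: "integrable M X" and pd: "\<And>\<omega>. \<omega> \<in> space M \<Longrightarrow> posdef (X \<omega>)"
  shows "posdef (integral\<^sup>L M X)"
  unfolding posdef_def
proof (intro conjI allI impI)
  show "self_adjoint (integral\<^sup>L M X)"
    using pd by (intro self_adjoint_integral int) (auto simp: posdef_def)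
  fix x :: "complex^'n" assume "x \<noteq> 0"
  let ?q = "\<lambda>A :: complex^'n^'n. x \<bullet> (A *v x)"
  have pos: "?q (X \<omega>) > 0" if "\<omega> \<in> space M" for \<omega>
    using pd[OF that] \<open>x \<noteq> 0\<close> by (simp add: posdef_def)
  note q = integral_linear_fun[OF linear_quadratic[of x] int]
  have "0 \<le> expectation (\<lambda>\<omega>. ?q (X \<omega>))"
    using pos by (intro integral_nonneg_AE) (auto intro: less_imp_le)
  moreover have "expectation (\<lambda>\<omega>. ?q (X \<omega>)) \<noteq> 0"
  proof
    assume "expectation (\<lambda>\<omega>. ?q (X \<omega>)) = 0"
    then have "AE \<omega> in M. ?q (X \<omega>) = 0"
      using pos by (subst (asm) integral_nonneg_eq_0_iff_AE[OF q(1)]) (auto intro: less_imp_le)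
    then have "AE \<omega> in M. False"
      using AE_space by eventually_elim (use pos in fastforce)
    then show False by simp
  qed
  ultimately show "0 < ?q (integral\<^sup>L M X)"
    unfolding q(2) by simp
qed

text \<open>Provides the integrable majorant in Lieb's theorem. Bounding \<open>K\<close> by a
  multiple of the identity yields an exponent commuting with \<open>X\<close>, so its exponential
  splits.\<close>

lemma retrace_exp_add_ln_le:
  fixes K X :: "complex^'n^'n"
  assumes K: "self_adjoint K" and X: "posdef X"
  shows "retrace (matfun exp (K + matfun ln X)) \<le> exp (norm K) * retrace X"
proof -
  have sa: "self_adjoint X" using X by (simp add: posdef_def)
  obtain U x where sd: "spectral_decomp U x X"
    using spectral_theorem[OF sa] .
  have eq: "norm K *\<^sub>R mat 1 + matfun ln X = matfun (\<lambda>x. norm K + ln x) X"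
    using matfun_add[OF sa, of "\<lambda>_. norm K * 1" ln] matfun_scaleR[OF sa, of "norm K" "\<lambda>_. 1"] matfun_one[OF sa]
    by simp
  have "retrace (matfun exp (K + matfun ln X)) \<le> retrace (matfun exp (norm K *\<^sub>R mat 1 + matfun ln X))"
    by (intro retrace_exp_mono self_adjoint_add self_adjoint_matfun self_adjoint_scaleR self_adjoint_one sa K
        loewner_le_add loewner_le_norm loewner_le_refl)
  also have "\<dots> = (\<Sum>i\<in>UNIV. exp (norm K + ln (x i)))"
    unfolding eq matfun_matfun[OF sa]
    using trace_spectral[OF matfun_spectral[OF sd, of "\<lambda>x. exp (norm K + ln x)"]] by simp
  also have "\<dots> = exp (norm K) * retrace X"
    using posdef_spectral_pos[OF X sd] trace_spectral[OF sd] by (simp add: exp_add sum_distrib_left)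
  finally show ?thesis .
qed

text \<open>Lieb's theorem in expectation form. Writing \<open>T = exp (K + log X)\<close>, the Gibbs principle
  turns the trace into an expression which is jointly concave in \<open>(T, X)\<close>; Jensen is applied to
  the pair, and the Gibbs principle once more at the expected pair.\<close>

lemma (in prob_space) lieb_expectation:
  fixes K :: "complex^'n^'n" and W :: "'a \<Rightarrow> complex^'n^'n"
  assumes K: "self_adjoint K"
    and W: "W \<in> borel_measurable M" "\<And>\<omega>. \<omega> \<in> space M \<Longrightarrow> self_adjoint (W \<omega>)"
    and int: "integrable M (\<lambda>\<omega>. matfun exp (W \<omega>))"
  shows "integrable M (\<lambda>\<omega>. retrace (matfun exp (K + W \<omega>)))"
    and "expectation (\<lambda>\<omega>. retrace (matfun exp (K + W \<omega>)))
         \<le> retrace (matfun exp (K + matfun ln (integral\<^sup>L M (\<lambda>\<omega>. matfun exp (W \<omega>)))))"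
proof -
  define X where "X = (\<lambda>\<omega>. matfun exp (W \<omega>))"
  define T where "T = (\<lambda>\<omega>. matfun exp (K + W \<omega>))"
  define Z where "Z = integral\<^sup>L M X"
  define S where "S = integral\<^sup>L M T"
  have Xpd: "posdef (X \<omega>)" and lnX: "matfun ln (X \<omega>) = W \<omega>" 
    and sa: "self_adjoint (K + W \<omega>)" and Tpd: "posdef (T \<omega>)" if "\<omega> \<in> space M" for \<omega>
  proof -
    show "posdef (X \<omega>)" "posdef (T \<omega>)" "self_adjoint (K + W \<omega>)"
      unfolding X_def T_def using W(2)[OF that] K by (auto intro!: posdef_matfun self_adjoint_add)
    show "matfun ln (X \<omega>) = W \<omega>"
      using W(2)[OF that] by (simp add: X_def matfun_matfun matfun_ident)
  qed
  have intX: "integrable M X" using int by (simp add: X_def)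
  have Tmeas: "T \<in> borel_measurable M"
    unfolding T_def using W(1) sa by (intro measurable_matfun continuous_intros) auto
  have intT: "integrable M T"
  proof (rule Bochner_Integration.integrable_bound[OF _ Tmeas])
    show "integrable M (\<lambda>\<omega>. exp (norm K) * retrace (X \<omega>))"
      by (intro integrable_mult_right integral_linear_fun(1)[OF linear_retrace intX])
    show "AE \<omega> in M. norm (T \<omega>) \<le> norm (exp (norm K) * retrace (X \<omega>))"
    proof (rule AE_I2)
      fix \<omega> assume w: "\<omega> \<in> space M"
      have "norm (T \<omega>) \<le> retrace (T \<omega>)"
        by (rule norm_le_retrace[OF Tpd[OF w]])
      also have "\<dots> \<le> exp (norm K) * retrace (X \<omega>)"
        using retrace_exp_add_ln_le[OF K Xpd[OF w]] by (simp add: T_def lnX[OF w])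
      finally show "norm (T \<omega>) \<le> norm (exp (norm K) * retrace (X \<omega>))" by simp
    qed
  qed
  note iT = integral_linear_fun[OF linear_retrace intT]
  show "integrable M (\<lambda>\<omega>. retrace (matfun exp (K + W \<omega>)))"
    using iT(1) by (simp add: T_def)
  have Spd: "posdef S" and Zpd: "posdef Z"
    unfolding S_def Z_def using intT intX Tpd Xpd by (auto intro!: posdef_integral)
  \<comment> \<open>The supporting functional is taken at the pair of means, so Jensen's inequality
    reduces to exchanging linear maps with the expectation.\<close>
  obtain f g where lin: "linear f" "linear g" and fg: "f S + g Z = relent S Z"
    and le: "\<And>T X. posdef T \<Longrightarrow> posdef X \<Longrightarrow> f T + g X \<le> relent T X"
    using relent_tangent[OF Spd Zpd] by blast
  have linK: "linear (\<lambda>T. retrace (T ** K))"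
    by (rule linearI)
       (simp_all add: matrix_add_mult_rdistrib trace_add matrix_mult_scaleR linear_cmul[OF linear_retrace])
  \<comment> \<open>With \<open>ln X = W\<close>, the equality case of Gibbs reads tr T = tr(T K) +
    tr X - D(T; X) pointwise; the supporting functional then bounds the entropy from below.\<close>
  have bound: "retrace (T \<omega>) \<le> retrace (T \<omega> ** K) + retrace (X \<omega>) - f (T \<omega>) - g (X \<omega>)" if w: "\<omega> \<in> space M" for \<omega>
    using gibbs_eq(2)[OF sa[OF w]] le[OF Tpd[OF w] Xpd[OF w]]
    unfolding relent_def lnX[OF w] T_def retrace_mult_add by linarith
  note ints = integral_linear_fun[OF linK intT] integral_linear_fun[OF linear_retrace intX]
    integral_linear_fun[OF lin(1) intT] integral_linear_fun[OF lin(2) intX]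
  have "expectation (\<lambda>\<omega>. retrace (T \<omega>))
      \<le> expectation (\<lambda>\<omega>. retrace (T \<omega> ** K) + retrace (X \<omega>) - f (T \<omega>) - g (X \<omega>))"
    by (intro integral_mono_AE iT ints Bochner_Integration.integrable_add Bochner_Integration.integrable_diff AE_I2 bound)
  also have "\<dots> = retrace (S ** K) + retrace Z - f S - g Z"
    using ints by (simp add: S_def Z_def)
  also have "\<dots> = retrace (S ** (K + matfun ln Z)) - retrace (S ** matfun ln S) + retrace S"
    using fg by (simp add: relent_def retrace_mult_add)
  also have "\<dots> \<le> retrace (matfun exp (K + matfun ln Z))"
    using Zpd by (intro gibbs_le Spd self_adjoint_add K self_adjoint_matfun) (simp add: posdef_def)
  finally show "expectation (\<lambda>\<omega>. retrace (matfun exp (K + W \<omega>)))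
         \<le> retrace (matfun exp (K + matfun ln (integral\<^sup>L M (\<lambda>\<omega>. matfun exp (W \<omega>)))))"
    by (simp add: T_def X_def Z_def)
qed

text \<open>The joint law is a product measure, so Tonelli applies without integrability conditions.
  Both factors are pulled back to \<open>M\<close>, which gives an inner integral over an
  independent sample point.\<close>

lemma (in prob_space) nn_integral_indep_var:
  assumes ind: "indep_var N1 S N2 W" and h: "h \<in> borel_measurable (N1 \<Otimes>\<^sub>M N2)"
  shows "(\<integral>\<^sup>+\<omega>. h (S \<omega>, W \<omega>) \<partial>M) = (\<integral>\<^sup>+\<omega>. (\<integral>\<^sup>+\<omega>'. h (S \<omega>, W \<omega>') \<partial>M) \<partial>M)"
proof -
  have S: "random_variable N1 S" and W: "random_variable N2 W"
    and eq: "distr M N1 S \<Otimes>\<^sub>M distr M N2 W = distr M (N1 \<Otimes>\<^sub>M N2) (\<lambda>x. (S x, W x))"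
    using ind by (auto simp: indep_var_distribution_eq)
  interpret W: prob_space "distr M N2 W"
    by (rule prob_space_distr) fact
  have "(\<integral>\<^sup>+\<omega>. h (S \<omega>, W \<omega>) \<partial>M) = (\<integral>\<^sup>+z. h z \<partial>(distr M N1 S \<Otimes>\<^sub>M distr M N2 W))"
    unfolding eq using S W h by (subst nn_integral_distr) auto
  also have "\<dots> = (\<integral>\<^sup>+s. \<integral>\<^sup>+w. h (s, w) \<partial>distr M N2 W \<partial>distr M N1 S)"
    using h by (intro W.nn_integral_fst[symmetric]) (simp cong: measurable_cong_sets)
  also have "\<dots> = (\<integral>\<^sup>+\<omega>. (\<integral>\<^sup>+w. h (S \<omega>, w) \<partial>distr M N2 W) \<partial>M)"
    using S h by (intro nn_integral_distr W.borel_measurable_nn_integral) (auto simp: case_prod_beta cong: measurable_cong_sets)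
  also have "\<dots> = (\<integral>\<^sup>+\<omega>. (\<integral>\<^sup>+\<omega>'. h (S \<omega>, W \<omega>') \<partial>M) \<partial>M)"
    using S W h measurable_space[OF S] by (intro nn_integral_cong nn_integral_distr) auto
  finally show ?thesis .
qed

lemma (in prob_space) indep_var_sum_insert:
  fixes X :: "'i \<Rightarrow> 'a \<Rightarrow> 'b :: euclidean_space"
  assumes "finite I" "i \<notin> I" and indep: "indep_vars (\<lambda>_. borel) X (insert i I)"
  shows "indep_var borel (\<lambda>\<omega>. \<Sum>i\<in>I. X i \<omega>) borel (X i)"
proof -
  have "indep_var
    borel ((\<lambda>f. \<Sum>i\<in>I. f i) \<circ> (\<lambda>\<omega>. restrict (\<lambda>i. X i \<omega>) I))
    borel ((\<lambda>f. f i) \<circ> (\<lambda>\<omega>. restrict (\<lambda>i. X i \<omega>) {i}))"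
    using assms by (intro indep_var_compose[OF indep_var_restrict[OF indep]]) auto
  also have "((\<lambda>f. f i) \<circ> (\<lambda>\<omega>. restrict (\<lambda>i. X i \<omega>) {i})) = X i"
    by auto
  also have "((\<lambda>f. \<Sum>i\<in>I. f i) \<circ> (\<lambda>\<omega>. restrict (\<lambda>i. X i \<omega>) I)) = (\<lambda>\<omega>. \<Sum>i\<in>I. X i \<omega>)"
    by (auto cong: rev_conj_cong)
  finally show ?thesis .
qed

text \<open>Tropp's master bound: the summands are integrated out one at a time by Lieb's theorem.\<close>

lemma (in prob_space) lieb_indep_sum:
  fixes K :: "complex^'n^'n" and W :: "'i \<Rightarrow> 'a \<Rightarrow> complex^'n^'n"
  assumes "finite J" "indep_vars (\<lambda>_. borel) W J" "self_adjoint K"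
    and "\<And>j \<omega>. j \<in> J \<Longrightarrow> \<omega> \<in> space M \<Longrightarrow> self_adjoint (W j \<omega>)"
    and "\<And>j. j \<in> J \<Longrightarrow> integrable M (\<lambda>\<omega>. matfun exp (W j \<omega>))"
  shows "(\<integral>\<^sup>+\<omega>. ennreal (retrace (matfun exp (K + (\<Sum>j\<in>J. W j \<omega>)))) \<partial>M)
    \<le> ennreal (retrace (matfun exp (K + (\<Sum>j\<in>J. matfun ln (integral\<^sup>L M (\<lambda>\<omega>. matfun exp (W j \<omega>)))))))"
  using assms
\<comment> \<open>\<open>K\<close> is generalised because each application of Lieb's theorem leaves
  a deterministic matrix \<open>L k\<close>, which joins \<open>K\<close> before the induction
  hypothesis is used.\<close>
proof (induction J arbitrary: K rule: finite_induct)
  case empty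
  then show ?case by (simp add: emeasure_space_1)
next
  case (insert k J)
  note K = insert.prems(2)
  define L where "L j = matfun ln (integral\<^sup>L M (\<lambda>\<omega>. matfun exp (W j \<omega>)))" for j
  \<comment> \<open>The Hermitian part makes \<open>h\<close> Borel on the whole product space; on
    the values actually taken it changes nothing (\<open>h_eq\<close>).\<close>
  define h where "h = (\<lambda>(s, w). ennreal (retrace (matfun exp (hermitian_part (K + (s + w))))))"
  have Wk: "W k \<in> borel_measurable M"
    using insert.prems(1) by (auto simp: indep_vars_def)
  have sak: "self_adjoint (W k \<omega>)" and saJ: "self_adjoint (\<Sum>j\<in>J. W j \<omega>)" if "\<omega> \<in> space M" for \<omega>
    using that insert.prems(3) by (auto intro!: self_adjoint_sum)
  have saL: "self_adjoint (L k)"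
    unfolding L_def using insert.prems(3,4) by (intro self_adjoint_matfun self_adjoint_integral) auto
  have h_eq: "h (\<Sum>j\<in>J. W j \<omega>, W k \<omega>') = ennreal (retrace (matfun exp ((K + (\<Sum>j\<in>J. W j \<omega>)) + W k \<omega>')))"
    if "\<omega> \<in> space M" "\<omega>' \<in> space M" for \<omega> \<omega>'
    unfolding h_def using saJ[OF that(1)] sak[OF that(2)] K
    by (simp add: hermitian_part_self_adjoint self_adjoint_add add.assoc)
  have "(\<lambda>z :: (complex^'n^'n) \<times> (complex^'n^'n). K + (fst z + snd z)) \<in> borel_measurable (borel \<Otimes>\<^sub>M borel)"
    by measurable
  moreover have "continuous_on UNIV (exp :: real \<Rightarrow> real)"
    by (intro continuous_intros)
  ultimately have h: "h \<in> borel_measurable (borel \<Otimes>\<^sub>M borel)"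
    unfolding h_def case_prod_beta
    by (intro measurable_compose[OF _ measurable_ennreal] measurable_compose[OF _ measurable_retrace]
        measurable_compose[OF _ measurable_matfun_hermitian])
  have "(\<integral>\<^sup>+\<omega>. ennreal (retrace (matfun exp (K + (\<Sum>j\<in>insert k J. W j \<omega>)))) \<partial>M)
      = (\<integral>\<^sup>+\<omega>. h (\<Sum>j\<in>J. W j \<omega>, W k \<omega>) \<partial>M)"
    using insert.hyps by (intro nn_integral_cong) (simp add: h_eq add_ac)
  also have "\<dots> = (\<integral>\<^sup>+\<omega>. (\<integral>\<^sup>+\<omega>'. h (\<Sum>j\<in>J. W j \<omega>, W k \<omega>') \<partial>M) \<partial>M)"
    by (rule nn_integral_indep_var[OF indep_var_sum_insert[OF insert.hyps insert.prems(1)] h])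
  also have "\<dots> \<le> (\<integral>\<^sup>+\<omega>. ennreal (retrace (matfun exp ((K + L k) + (\<Sum>j\<in>J. W j \<omega>)))) \<partial>M)"
  proof (rule nn_integral_mono)
    fix \<omega> assume w: "\<omega> \<in> space M"
    have sa: "self_adjoint (K + (\<Sum>j\<in>J. W j \<omega>))"
      by (intro self_adjoint_add K saJ w)
    note lieb = lieb_expectation[OF sa Wk sak insert.prems(4)[of k, simplified]]
    have "(\<integral>\<^sup>+\<omega>'. h (\<Sum>j\<in>J. W j \<omega>, W k \<omega>') \<partial>M)
        = (\<integral>\<^sup>+\<omega>'. ennreal (retrace (matfun exp ((K + (\<Sum>j\<in>J. W j \<omega>)) + W k \<omega>'))) \<partial>M)"
      by (intro nn_integral_cong h_eq w)
    also have "\<dots> = ennreal (expectation (\<lambda>\<omega>'. retrace (matfun exp ((K + (\<Sum>j\<in>J. W j \<omega>)) + W k \<omega>'))))"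
      by (intro nn_integral_eq_integral lieb(1) AE_I2 retrace_matfun_exp_nonneg self_adjoint_add sa sak)
    also have "\<dots> \<le> ennreal (retrace (matfun exp ((K + (\<Sum>j\<in>J. W j \<omega>)) + L k)))"
      unfolding L_def by (intro ennreal_leI lieb(2))
    finally show "(\<integral>\<^sup>+\<omega>'. h (\<Sum>j\<in>J. W j \<omega>, W k \<omega>') \<partial>M)
        \<le> ennreal (retrace (matfun exp ((K + L k) + (\<Sum>j\<in>J. W j \<omega>))))"
      by (simp add: add_ac)
  qed
  also have "\<dots> \<le> ennreal (retrace (matfun exp ((K + L k) + (\<Sum>j\<in>J. L j))))"
    unfolding L_def[symmetric]
    using insert.prems(3,4)
    by (intro insert.IH[folded L_def] indep_vars_subset[OF insert.prems(1)] self_adjoint_add K saL) auto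
  also have "(K + L k) + (\<Sum>j\<in>J. L j) = K + (\<Sum>j\<in>insert k J. L j)"
    using insert.hyps by (simp add: add_ac)
  finally show ?case unfolding L_def .
qed

subsection \<open>The truncation function\<close>

text \<open>It suffices that \<open>\<bar>x\<bar> < 1 + c * \<bar>x\<bar> powr \<alpha>\<close>,
  which is proved after squaring. The weights \<open>2 * A\<close> and \<open>B\<close> sum to 1 and
  satisfy \<open>2 * A * (\<alpha> - 2) + B * (2 * \<alpha> - 2) = 0\<close>, so the terms linear in
  \<open>L\<close> cancel when both exponentials are bounded below by their tangents at 0.\<close>

lemma one_plus_c_alpha_pos:
  assumes "1 < \<alpha>" "\<alpha> \<le> 2"
  shows "0 < 1 + x + c_alpha \<alpha> * \<bar>x\<bar> powr \<alpha>"
proof (cases "x = 0")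
  case False
  define A B c L where "A = (\<alpha> - 1) / \<alpha>" and "B = (2 - \<alpha>) / \<alpha>" and "c = c_alpha \<alpha>" and "L = ln \<bar>x\<bar>"
  have AB: "A \<ge> 0" "B \<ge> 0"
    using assms by (auto simp: A_def B_def)
  have c: "c \<ge> A" "c \<ge> sqrt B"
    by (auto simp: c_def c_alpha_def A_def B_def)
  then have c0: "c \<ge> 0" using AB by linarith
  have c2: "c\<^sup>2 \<ge> B"
    using power_mono[OF c(2), of 2] AB(2) by simp
  have x: "\<bar>x\<bar> = exp L" using False by (simp add: L_def)
  have p: "\<bar>x\<bar> powr \<alpha> = exp (\<alpha> * L)"
    using False by (simp add: powr_def L_def)
  \<comment> \<open>Weighted AM-GM, \<open>y\<^sup>2 \<le> 2 * c * y powr \<alpha> + c\<^sup>2 * y powr (2 * \<alpha>)\<close> for \<open>y = \<bar>x\<bar>\<close>, as \<open>2 * A + B = 1\<close>.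
    This is where both terms of the maximum defining \<open>c\<close> are needed.\<close>
  have "1 = 2 * A * (1 + (\<alpha> - 2) * L) + B * (1 + (2 * \<alpha> - 2) * L)"
    using assms by (simp add: A_def B_def field_simps)
  also have "\<dots> \<le> 2 * A * exp ((\<alpha> - 2) * L) + B * exp ((2 * \<alpha> - 2) * L)"
    using AB by (intro add_mono mult_left_mono exp_ge_add_one_self) auto
  also have "\<dots> \<le> 2 * c * exp ((\<alpha> - 2) * L) + c\<^sup>2 * exp ((2 * \<alpha> - 2) * L)"
    using c c2 by (intro add_mono mult_right_mono) auto
  finally have "exp (2 * L) * 1 \<le> exp (2 * L) * (2 * c * exp ((\<alpha> - 2) * L) + c\<^sup>2 * exp ((2 * \<alpha> - 2) * L))"
    by (intro mult_left_mono) auto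
  also have "\<dots> = 2 * c * (exp (2 * L) * exp ((\<alpha> - 2) * L)) + c\<^sup>2 * (exp (2 * L) * exp ((2 * \<alpha> - 2) * L))"
    by (simp add: algebra_simps)
  also have "\<dots> = 2 * c * exp (\<alpha> * L) + (c * exp (\<alpha> * L))\<^sup>2"
  proof -
    have "exp (2 * L) * exp ((\<alpha> - 2) * L) = exp (\<alpha> * L)"
      "exp (2 * L) * exp ((2 * \<alpha> - 2) * L) = exp (\<alpha> * L) * exp (\<alpha> * L)"
      unfolding mult_exp_exp by (rule arg_cong[of _ _ exp], algebra)+
    then show ?thesis by (simp only: power_mult_distrib power2_eq_square[of "exp _"])
  qed
  also have "\<dots> < (1 + c * exp (\<alpha> * L))\<^sup>2"
    unfolding power2_sum by simp
  finally have "\<bar>x\<bar>\<^sup>2 < (1 + c * exp (\<alpha> * L))\<^sup>2"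
    by (simp only: x exp_double mult_1_right)
  then have "\<bar>x\<bar> < 1 + c * exp (\<alpha> * L)"
    by (rule power2_less_imp_less) (use c0 in simp)
  then show ?thesis
    unfolding p c_def[symmetric] by linarith
qed simp

subsection \<open>Operator norm\<close>

lemma bounded_linear_matrix_vector_complex: "bounded_linear (\<lambda>x. (A :: complex^'n^'n) *v x)"
  using linear_matrix_vector_complex by (simp add: linear_conv_bounded_linear)

lemma loewner_le_opnorm:
  assumes "opnorm A \<le> v"
  shows "loewner_le A (v *\<^sub>R mat 1)"
  unfolding loewner_le_def
proof
  fix x
  have "x \<bullet> (A *v x) \<le> norm x * norm (A *v x)"
    by (rule norm_cauchy_schwarz)
  also have "\<dots> \<le> norm x * (opnorm A * norm x)"
    unfolding opnorm_def by (intro mult_left_mono onorm bounded_linear_matrix_vector_complex) auto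
  also have "\<dots> \<le> norm x * (v * norm x)"
    using assms by (intro mult_left_mono mult_right_mono) auto
  also have "\<dots> = x \<bullet> ((v *\<^sub>R mat 1) *v x)"
    by (simp only: matrix_vector_scaleR_left inner_scaleR_right matrix_vector_mul_lid
        power2_norm_eq_inner[symmetric] power2_eq_square mult_ac)
  finally show "x \<bullet> (A *v x) \<le> x \<bullet> ((v *\<^sub>R mat 1) *v x)" .
qed

text \<open>The largest absolute eigenvalue \<open>b\<close> is attained and bounds the operator
  norm, because the squared length of \<open>A *v x\<close> is the quadratic form of
  \<open>A ** A\<close>, with eigenvalues at most \<open>b\<^sup>2\<close>.\<close>

lemma opnorm_ge_eigenvalue:
  fixes A :: "complex^'n^'n"
  assumes sd: "spectral_decomp U l A" and t: "t \<le> opnorm A"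
  obtains i where "t \<le> \<bar>l i\<bar>"
proof -
  define b where "b = Max (range (\<lambda>i. \<bar>l i\<bar>))"
  have b: "\<bar>l i\<bar> \<le> b" for i
    unfolding b_def by (intro Max_ge) auto
  have "b \<in> range (\<lambda>i. \<bar>l i\<bar>)"
    unfolding b_def by (intro Max_in) auto
  then obtain i where i: "b = \<bar>l i\<bar>" by auto
  have "opnorm A \<le> b"
    unfolding opnorm_def
  proof (rule onorm_le)
    fix x
    have "(norm (A *v x))\<^sup>2 = (A *v x) \<bullet> (A *v x)"
      by (simp only: power2_norm_eq_inner)
    also have "\<dots> = x \<bullet> ((A ** A) *v x)"
      using inner_matrix_vector[of x A "A *v x"] self_adjoint_spectral[OF sd]
      by (simp add: self_adjoint_def matrix_vector_mul_assoc)
    also have "\<dots> \<le> b\<^sup>2 * (x \<bullet> x)"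
      unfolding spectral_quadratic(1)[OF spectral_decomp_mult[OF sd sd]] spectral_quadratic(2)[OF sd] sum_distrib_left
    proof (intro sum_mono mult_right_mono)
      show "l i * l i \<le> b\<^sup>2" for i
        using power_mono[OF b[of i], of 2] by (simp add: power2_eq_square)
    qed simp
    also have "\<dots> = (b * norm x)\<^sup>2"
      by (simp only: power_mult_distrib power2_norm_eq_inner)
    finally show "norm (A *v x) \<le> b * norm x"
      by (rule power2_le_imp_le) (simp add: i)
  qed
  then show ?thesis
    using that[of i] i t by simp
qed

lemma exp_le_retrace_exp:
  fixes A :: "complex^'n^'n"
  assumes sd: "spectral_decomp U l A"
  shows "exp (l i) \<le> retrace (matfun exp A)"
  using trace_spectral[OF matfun_spectral[OF sd, of exp]] member_le_sum[of i UNIV "\<lambda>i. exp (l i)"]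
  by simp

text \<open>The source of the dimension factor in the final bound.\<close>

lemma retrace_exp_scaleR_one: "retrace (matfun exp (a *\<^sub>R (mat 1 :: complex^'n^'n))) = CARD('n) * exp a"
proof -
  have "unitary_mat (mat 1 :: complex^'n^'n)"
    using self_adjoint_one by (simp add: unitary_mat_def self_adjoint_def)
  then have "spectral_decomp (mat 1) (\<lambda>_. a * 1) (a *\<^sub>R (mat 1 :: complex^'n^'n))"
    by (intro spectral_decomp_scaleR spectral_decomp_one)
  from trace_spectral[OF matfun_spectral[OF this, of exp]] show ?thesis by simp
qed

subsection \<open>The concentration inequality\<close>

text \<open>One-sided bound with \<open>f\<close>, the upper envelope of the admissible truncations;
  it is used for \<open>Y\<close> and for its negative. It combines Markov's inequality for the
  trace exponential with Lieb's theorem and the exact value of the expectation of exp(f(theta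
  Y)).\<close>

lemma (in prob_space) trace_exp_tail:
  fixes Y :: "'i \<Rightarrow> 'a \<Rightarrow> complex^'d^'d" and \<alpha> \<theta> t v :: real
  assumes \<alpha>: "1 < \<alpha>" "\<alpha> \<le> 2" and "finite J"
    and ind: "indep_vars (\<lambda>_. borel) Y J"
    and sa: "\<And>j \<omega>. j \<in> J \<Longrightarrow> \<omega> \<in> space M \<Longrightarrow> self_adjoint (Y j \<omega>)"
    and int: "\<And>j. j \<in> J \<Longrightarrow> integrable M (\<lambda>\<omega>. mabs_powr (Y j \<omega>) \<alpha>)"
    and v: "opnorm (\<Sum>j\<in>J. integral\<^sup>L M (\<lambda>\<omega>. mabs_powr (Y j \<omega>) \<alpha>)) \<le> v"
    and "\<theta> > 0"
  defines "f \<equiv> \<lambda>x. ln (1 + x + c_alpha \<alpha> * \<bar>x\<bar> powr \<alpha>)"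
  defines "E \<equiv> {\<omega> \<in> space M. exp (\<theta> * t) \<le>
    retrace (matfun exp (\<Sum>j\<in>J. matfun f (\<theta> *\<^sub>R Y j \<omega>) - \<theta> *\<^sub>R integral\<^sup>L M (Y j)))}"
  shows "E \<in> events" "prob E \<le> CARD('d) * exp (- \<theta> * t + c_alpha \<alpha> * \<theta> powr \<alpha> * v)"
    and "\<And>j. j \<in> J \<Longrightarrow> self_adjoint (integral\<^sup>L M (Y j))"
proof -
  define c where "c = c_alpha \<alpha>"
  define W where "W = (\<lambda>j \<omega>. matfun f (hermitian_part (\<theta> *\<^sub>R Y j \<omega>)))"
  have c0: "c \<ge> 0"
    using \<alpha> by (auto simp: c_def c_alpha_def le_max_iff_disj)
  have pos: "0 < 1 + x + c * \<bar>x\<bar> powr \<alpha>" for x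
    unfolding c_def by (rule one_plus_c_alpha_pos[OF \<alpha>])
  have cont_abs: "continuous_on UNIV (\<lambda>x :: real. \<bar>x\<bar> powr \<alpha>)"
    using \<alpha> by (intro continuous_on_powr' continuous_intros) auto
  have contf: "continuous_on UNIV f"
    unfolding f_def c_def[symmetric] using pos
    by (intro continuous_intros cont_abs) (auto dest: less_imp_neq[THEN not_sym])
  have Ymeas: "Y j \<in> borel_measurable M" if "j \<in> J" for j
    using ind that by (auto simp: indep_vars_def)
  \<comment> \<open>The alpha-moment controls the first moment through the scalar bound
    \<open>\<bar>x\<bar> \<le> 1 + \<bar>x\<bar> powr \<alpha>\<close>, transferred to Frobenius
    norms by \<open>norm_matfun_mono\<close>.\<close>
  have intY: "integrable M (Y j)" if j: "j \<in> J" for j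
  proof (rule Bochner_Integration.integrable_bound[OF _ Ymeas[OF j]])
    show "integrable M (\<lambda>\<omega>. mat 1 + mabs_powr (Y j \<omega>) \<alpha>)"
      by (intro Bochner_Integration.integrable_add int j) simp
    have "\<bar>x\<bar> \<le> \<bar>1 + \<bar>x\<bar> powr \<alpha>\<bar>" for x :: real
    proof (cases "\<bar>x\<bar> \<le> 1")
      case False
      then have "\<bar>x\<bar> powr 1 \<le> \<bar>x\<bar> powr \<alpha>" using \<alpha> by (intro powr_mono) auto
      then show ?thesis using False by simp
    qed (simp add: add_increasing2)
    then have "norm (matfun (\<lambda>x. x) (Y j \<omega>)) \<le> norm (matfun (\<lambda>x. 1 + \<bar>x\<bar> powr \<alpha>) (Y j \<omega>))"
      if "\<omega> \<in> space M" for \<omega>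
      by (intro norm_matfun_mono sa j that)
    then show "AE \<omega> in M. norm (Y j \<omega>) \<le> norm (mat 1 + mabs_powr (Y j \<omega>) \<alpha>)"
      using sa[OF j] by (auto intro!: AE_I2 simp: matfun_ident mabs_powr_def matfun_add[symmetric] matfun_one)
  qed
  show saE: "self_adjoint (integral\<^sup>L M (Y j))" if "j \<in> J" for j
    using that by (intro self_adjoint_integral intY sa)
  have W_eq: "W j \<omega> = matfun f (\<theta> *\<^sub>R Y j \<omega>)" if "j \<in> J" "\<omega> \<in> space M" for j \<omega>
    using sa[OF that] by (simp add: W_def hermitian_part_self_adjoint self_adjoint_scaleR)
  have saW: "self_adjoint (W j \<omega>)" for j \<omega>
    unfolding W_def by (intro self_adjoint_matfun self_adjoint_hermitian_part)
  have indW: "indep_vars (\<lambda>_. borel) W J"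
    unfolding W_def
  proof (rule indep_vars_compose2[OF ind])
    have "(\<lambda>A :: complex^'d^'d. \<theta> *\<^sub>R A) \<in> borel_measurable borel" by measurable
    from measurable_compose[OF this measurable_matfun_hermitian[OF contf]]
    show "(\<lambda>A :: complex^'d^'d. matfun f (hermitian_part (\<theta> *\<^sub>R A))) \<in> borel_measurable borel" .
  qed
  have expW: "matfun exp (W j \<omega>) = mat 1 + \<theta> *\<^sub>R Y j \<omega> + (c * \<theta> powr \<alpha>) *\<^sub>R mabs_powr (Y j \<omega>) \<alpha>"
    if j: "j \<in> J" "\<omega> \<in> space M" for j \<omega>
  proof -
    note s = sa[OF j]
    have "matfun exp (W j \<omega>) = matfun (\<lambda>x. 1 + \<theta> * x + c * \<bar>\<theta> * x\<bar> powr \<alpha>) (Y j \<omega>)"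
      using pos by (simp add: W_eq[OF j] matfun_matfun[OF s] matfun_scaleR_arg[OF s] f_def c_def)
    also have "(\<lambda>x. 1 + \<theta> * x + c * \<bar>\<theta> * x\<bar> powr \<alpha>) = (\<lambda>x. 1 + \<theta> * x + (c * \<theta> powr \<alpha>) * \<bar>x\<bar> powr \<alpha>)"
      using \<open>\<theta> > 0\<close> by (simp add: abs_mult powr_mult mult.assoc)
    also have "matfun \<dots> (Y j \<omega>) = mat 1 + \<theta> *\<^sub>R Y j \<omega> + (c * \<theta> powr \<alpha>) *\<^sub>R mabs_powr (Y j \<omega>) \<alpha>"
      by (simp add: matfun_add[OF s, symmetric] matfun_scaleR[OF s, symmetric] matfun_one[OF s] matfun_ident[OF s] mabs_powr_def)
    finally show ?thesis .
  qed
  define Z where "Z j = integral\<^sup>L M (\<lambda>\<omega>. matfun exp (W j \<omega>))" for j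
  have intExp: "integrable M (\<lambda>\<omega>. matfun exp (W j \<omega>))" if j: "j \<in> J" for j
  proof -
    have "integrable M (\<lambda>\<omega>. mat 1 + \<theta> *\<^sub>R Y j \<omega> + (c * \<theta> powr \<alpha>) *\<^sub>R mabs_powr (Y j \<omega>) \<alpha>)"
      by (intro Bochner_Integration.integrable_add integrable_scaleR_right int intY j) simp
    then show ?thesis
      by (rule Bochner_Integration.integrable_cong[THEN iffD1, rotated 2]) (simp_all add: expW[OF j])
  qed
  have Z_eq: "Z j = mat 1 + \<theta> *\<^sub>R integral\<^sup>L M (Y j) + (c * \<theta> powr \<alpha>) *\<^sub>R integral\<^sup>L M (\<lambda>\<omega>. mabs_powr (Y j \<omega>) \<alpha>)"
    if j: "j \<in> J" for j
  proof -
    have "Z j = integral\<^sup>L M (\<lambda>\<omega>. mat 1 + \<theta> *\<^sub>R Y j \<omega> + (c * \<theta> powr \<alpha>) *\<^sub>R mabs_powr (Y j \<omega>) \<alpha>)"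
      unfolding Z_def by (intro Bochner_Integration.integral_cong expW j) auto
    also have "\<dots> = mat 1 + \<theta> *\<^sub>R integral\<^sup>L M (Y j) + (c * \<theta> powr \<alpha>) *\<^sub>R integral\<^sup>L M (\<lambda>\<omega>. mabs_powr (Y j \<omega>) \<alpha>)"
      using int[OF j] intY[OF j] by (simp add: prob_space)
    finally show ?thesis .
  qed
  have posZ: "posdef (Z j)" if j: "j \<in> J" for j
    unfolding Z_def using saW by (intro posdef_integral intExp j posdef_matfun) auto
  \<comment> \<open>The deterministic centering is the initial fixed matrix in
    \<open>lieb_indep_sum\<close>.\<close>
  define K where "K = - (\<Sum>j\<in>J. \<theta> *\<^sub>R integral\<^sup>L M (Y j))"
  have saK: "self_adjoint K"
    unfolding K_def using self_adjoint_diff[OF self_adjoint_zero self_adjoint_sum[of J "\<lambda>j. \<theta> *\<^sub>R integral\<^sup>L M (Y j)"]] saE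
    by (auto simp: self_adjoint_scaleR)
  have saZ: "self_adjoint (Z j)" if "j \<in> J" for j
    using posZ[OF that] by (simp add: posdef_def)
  have lnZ: "loewner_le (matfun ln (Z j)) (Z j - mat 1)" if j: "j \<in> J" for j
  proof -
    have "loewner_le (matfun ln (Z j)) (matfun (\<lambda>x. x + (-1) * 1) (Z j))"
      using posZ[OF j] ln_le_minus_one by (intro matfun_mono saZ[OF j]) auto
    also have "matfun (\<lambda>x. x + (-1) * 1) (Z j) = Z j - mat 1"
      unfolding matfun_add[OF saZ[OF j], symmetric] matfun_scaleR[OF saZ[OF j], symmetric]
        matfun_one[OF saZ[OF j]] matfun_ident[OF saZ[OF j]] by simp
    finally show ?thesis .
  qed
  define V where "V = (\<Sum>j\<in>J. integral\<^sup>L M (\<lambda>\<omega>. mabs_powr (Y j \<omega>) \<alpha>))"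
  have "loewner_le (K + (\<Sum>j\<in>J. matfun ln (Z j))) (K + (\<Sum>j\<in>J. Z j - mat 1))"
    by (intro loewner_le_add loewner_le_refl loewner_le_sum lnZ)
  \<comment> \<open>The identities cancel in each \<open>Z j - mat 1\<close>, and \<open>K\<close>
    removes the first moments.\<close>
  also have "K + (\<Sum>j\<in>J. Z j - mat 1) = (c * \<theta> powr \<alpha>) *\<^sub>R V"
    unfolding K_def V_def by (simp add: Z_eq sum.distrib scaleR_sum_right)
  finally have "loewner_le (K + (\<Sum>j\<in>J. matfun ln (Z j))) ((c * \<theta> powr \<alpha>) *\<^sub>R (v *\<^sub>R mat 1))"
    by (rule loewner_le_trans) (intro loewner_le_scaleR loewner_le_opnorm v[folded V_def] mult_nonneg_nonneg c0 powr_ge_zero)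
  then have "retrace (matfun exp (K + (\<Sum>j\<in>J. matfun ln (Z j)))) \<le> retrace (matfun exp ((c * \<theta> powr \<alpha> * v) *\<^sub>R mat 1 :: complex^'d^'d))"
    using saK saZ
    by (intro retrace_exp_mono self_adjoint_add self_adjoint_sum self_adjoint_matfun self_adjoint_scaleR self_adjoint_one)
       (simp_all add: mult.assoc)
  then have trace_le: "retrace (matfun exp (K + (\<Sum>j\<in>J. matfun ln (Z j)))) \<le> CARD('d) * exp (c * \<theta> powr \<alpha> * v)"
    by (simp add: retrace_exp_scaleR_one)
  define u where "u = (\<lambda>\<omega>. retrace (matfun exp (K + (\<Sum>j\<in>J. W j \<omega>))))"
  have Wmeas: "W j \<in> borel_measurable M" if "j \<in> J" for j
    using indW that by (auto simp: indep_vars_def)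
  have "(\<lambda>\<omega>. K + (\<Sum>j\<in>J. W j \<omega>)) \<in> borel_measurable M"
    using Wmeas by (intro borel_measurable_add borel_measurable_sum) auto
  then have u: "u \<in> borel_measurable M"
    unfolding u_def using saK saW
    by (intro measurable_compose[OF _ measurable_retrace] measurable_matfun self_adjoint_add self_adjoint_sum continuous_intros)
  have E_eq: "E = {\<omega> \<in> space M. exp (\<theta> * t) \<le> u \<omega>}"
    unfolding E_def u_def K_def by (intro Collect_cong conj_cong refl) (simp add: W_eq sum_subtractf)
  then show E: "E \<in> events"
    using u by simp
  have E_eq': "E = {\<omega> \<in> space M. 1 \<le> ennreal (exp (- \<theta> * t)) * ennreal (u \<omega>)}"
    unfolding E_eq
  proof (intro Collect_cong conj_cong refl)
    fix \<omega>
    have "exp (\<theta> * t) \<le> u \<omega> \<longleftrightarrow> 1 \<le> exp (- \<theta> * t) * u \<omega>"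
      by (simp add: exp_minus field_simps)
    also have "\<dots> \<longleftrightarrow> 1 \<le> ennreal (exp (- \<theta> * t) * u \<omega>)"
      using ennreal_le_iff2[of 1 "exp (- \<theta> * t) * u \<omega>"] by auto
    finally show "exp (\<theta> * t) \<le> u \<omega> \<longleftrightarrow> 1 \<le> ennreal (exp (- \<theta> * t)) * ennreal (u \<omega>)"
      by (simp add: ennreal_mult')
  qed
  have "emeasure M E \<le> ennreal (exp (- \<theta> * t)) * (\<integral>\<^sup>+\<omega>. ennreal (u \<omega>) * indicator (space M) \<omega> \<partial>M)"
    unfolding E_eq' using u by (intro nn_integral_Markov_inequality) auto
  also have "(\<integral>\<^sup>+\<omega>. ennreal (u \<omega>) * indicator (space M) \<omega> \<partial>M) = (\<integral>\<^sup>+\<omega>. ennreal (u \<omega>) \<partial>M)"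
    by (intro nn_integral_cong) simp
  also have "ennreal (exp (- \<theta> * t)) * (\<integral>\<^sup>+\<omega>. ennreal (u \<omega>) \<partial>M)
      \<le> ennreal (exp (- \<theta> * t)) * ennreal (retrace (matfun exp (K + (\<Sum>j\<in>J. matfun ln (Z j)))))"
    unfolding u_def Z_def
    by (intro mult_left_mono lieb_indep_sum indW saK saW intExp \<open>finite J\<close>) auto
  also have "\<dots> \<le> ennreal (exp (- \<theta> * t)) * ennreal (CARD('d) * exp (c * \<theta> powr \<alpha> * v))"
    by (intro mult_left_mono ennreal_leI trace_le) auto
  also have "\<dots> = ennreal (CARD('d) * exp (- \<theta> * t + c * \<theta> powr \<alpha> * v))"
    by (simp add: ennreal_mult'[symmetric] exp_diff exp_minus field_simps)
  finally show "prob E \<le> CARD('d) * exp (- \<theta> * t + c_alpha \<alpha> * \<theta> powr \<alpha> * v)"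
    by (simp add: emeasure_eq_measure c_def)
qed

theorem theorem3p3:
  fixes M :: "'a measure" and Y :: "nat \<Rightarrow> 'a \<Rightarrow> complex^'d^'d"
    and \<psi> :: "real \<Rightarrow> real" and \<alpha> \<theta> t v :: real and n :: nat
  assumes "prob_space M"
    and "1 < \<alpha>" and "\<alpha> \<le> 2"
    and "\<And>x. - ln (1 - x + c_alpha \<alpha> * \<bar>x\<bar> powr \<alpha>) \<le> \<psi> x"
    and "\<And>x. \<psi> x \<le> ln (1 + x + c_alpha \<alpha> * \<bar>x\<bar> powr \<alpha>)"
    and "\<psi> \<in> borel_measurable borel"
    and "prob_space.indep_vars M (\<lambda>_. borel) Y {1..n}"
    and "\<And>j \<omega>. j \<in> {1..n} \<Longrightarrow> \<omega> \<in> space M \<Longrightarrow> self_adjoint (Y j \<omega>)"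
    and "\<And>j. j \<in> {1..n} \<Longrightarrow> integrable M (\<lambda>\<omega>. mabs_powr (Y j \<omega>) \<alpha>)"
    and "v \<ge> opnorm (\<Sum>j=1..n. integral\<^sup>L M (\<lambda>\<omega>. mabs_powr (Y j \<omega>) \<alpha>))"
    and "t > 0" and "\<theta> > 0"
  shows "measure M {\<omega> \<in> space M.
            opnorm (\<Sum>j=1..n. (1 / \<theta>) *\<^sub>R matfun \<psi> (\<theta> *\<^sub>R Y j \<omega>) - integral\<^sup>L M (Y j)) \<ge> t}
         \<le> 2 * real CARD('d) * exp (- \<theta> * t + c_alpha \<alpha> * \<theta> powr \<alpha> * v)"
proof -
  interpret prob_space M by (rule assms(1))
  define J where "J = {1..n}"
  define f where "f x = ln (1 + x + c_alpha \<alpha> * \<bar>x\<bar> powr \<alpha>)" for x :: real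
  define E where "E Y = {\<omega> \<in> space M. exp (\<theta> * t) \<le>
    retrace (matfun exp (\<Sum>j\<in>J. matfun f (\<theta> *\<^sub>R Y j \<omega>) - \<theta> *\<^sub>R integral\<^sup>L M (Y j)))}"
    for Y :: "nat \<Rightarrow> 'a \<Rightarrow> complex^'d^'d"
  \<comment> \<open>The lower tail is the upper tail for the negated matrices: \<open>\<psi>\<close>
    turns into \<open>\<lambda>x. - \<psi> (- x)\<close>, which the lower bound on
    \<open>\<psi>\<close> places below the same \<open>f\<close>, and the moments of the absolute
    values are unchanged.\<close>
  define Y' where "Y' = (\<lambda>j \<omega>. - Y j \<omega>)"
  define b where "b = CARD('d) * exp (- \<theta> * t + c_alpha \<alpha> * \<theta> powr \<alpha> * v)"
  note sa = assms(8)[folded J_def]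
  have mabs': "mabs_powr (Y' j \<omega>) \<alpha> = mabs_powr (Y j \<omega>) \<alpha>" if "j \<in> J" "\<omega> \<in> space M" for j \<omega>
    using matfun_scaleR_arg[OF sa[OF that], of "\<lambda>x. \<bar>x\<bar> powr \<alpha>" "-1"] by (simp add: Y'_def mabs_powr_def)
  have int_mabs': "integral\<^sup>L M (\<lambda>\<omega>. mabs_powr (Y' j \<omega>) \<alpha>) = integral\<^sup>L M (\<lambda>\<omega>. mabs_powr (Y j \<omega>) \<alpha>)" if "j \<in> J" for j
    by (intro Bochner_Integration.integral_cong mabs' that refl)
  have finJ: "finite J" by (simp add: J_def)
  note hyps = assms(2,3) finJ assms(7)[folded J_def] sa assms(9)[folded J_def] assms(10)[folded J_def] assms(12)
  have E: "E Y \<in> events" "prob (E Y) \<le> b"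
    using trace_exp_tail(1,2)[where t = t, OF hyps, folded f_def b_def] by (simp_all add: E_def)
  have saE: "self_adjoint (integral\<^sup>L M (Y j))" if "j \<in> J" for j
    by (rule trace_exp_tail(3)[OF hyps that])
  have E': "E Y' \<in> events \<and> prob (E Y') \<le> b"
  proof -
    have ind: "indep_vars (\<lambda>_. borel) Y' J"
      unfolding Y'_def by (rule indep_vars_compose2[OF assms(7)[folded J_def]]) simp
    have sa': "self_adjoint (Y' j \<omega>)" if "j \<in> J" "\<omega> \<in> space M" for j \<omega>
      using self_adjoint_scaleR[OF sa[OF that], of "-1"] by (simp add: Y'_def)
    have int': "integrable M (\<lambda>\<omega>. mabs_powr (Y' j \<omega>) \<alpha>)" if "j \<in> J" for j
      using assms(9)[folded J_def, OF that]
      by (rule Bochner_Integration.integrable_cong[THEN iffD1, rotated 2]) (simp_all add: mabs' that)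
    have v': "opnorm (\<Sum>j\<in>J. integral\<^sup>L M (\<lambda>\<omega>. mabs_powr (Y' j \<omega>) \<alpha>)) \<le> v"
      using assms(10)[folded J_def] by (simp add: int_mabs')
    show ?thesis
      using trace_exp_tail(1,2)[where t = t, OF assms(2,3) finJ ind sa' int' v' assms(12), folded f_def b_def]
      by (simp add: E_def)
  qed
  let ?R = "\<lambda>\<omega>. \<Sum>j\<in>J. (1 / \<theta>) *\<^sub>R matfun \<psi> (\<theta> *\<^sub>R Y j \<omega>) - integral\<^sup>L M (Y j)"
  have sub: "{\<omega> \<in> space M. opnorm (?R \<omega>) \<ge> t} \<subseteq> E Y \<union> E Y'"
  proof clarify
    fix \<omega> assume w: "\<omega> \<in> space M" and ge: "t \<le> opnorm (?R \<omega>)" and notin: "\<omega> \<notin> E Y'"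
    have saY: "self_adjoint (\<theta> *\<^sub>R Y j \<omega>)" if "j \<in> J" for j
      by (intro self_adjoint_scaleR sa that w)
    have saR: "self_adjoint (?R \<omega>)"
      by (auto intro!: self_adjoint_sum self_adjoint_diff self_adjoint_scaleR self_adjoint_matfun sa w saE)
    obtain U r where sd: "spectral_decomp U r (?R \<omega>)"
      using spectral_theorem[OF saR] .
    obtain i where i: "t \<le> \<bar>r i\<bar>"
      using opnorm_ge_eigenvalue[OF sd ge] .
    have R: "\<theta> *\<^sub>R ?R \<omega> = (\<Sum>j\<in>J. matfun \<psi> (\<theta> *\<^sub>R Y j \<omega>) - \<theta> *\<^sub>R integral\<^sup>L M (Y j))"
      using assms(12) by (simp add: scaleR_sum_right scaleR_diff_right)
    \<comment> \<open>The comparison is made inside the exponent, where Loewner inequalities add up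
      over the summands; the trace exponential is applied only afterwards.\<close>
    have mono: "retrace (matfun exp (\<Sum>j\<in>J. matfun g (A j) - \<theta> *\<^sub>R B j))
        \<le> retrace (matfun exp (\<Sum>j\<in>J. matfun f (A j) - \<theta> *\<^sub>R B j))"
      if A: "\<And>j. j \<in> J \<Longrightarrow> self_adjoint (A j)" and B: "\<And>j. j \<in> J \<Longrightarrow> self_adjoint (B j)"
        and g: "\<And>x. g x \<le> f x" for g and A B :: "nat \<Rightarrow> complex^'d^'d"
    proof (rule retrace_exp_mono)
      show "loewner_le (\<Sum>j\<in>J. matfun g (A j) - \<theta> *\<^sub>R B j) (\<Sum>j\<in>J. matfun f (A j) - \<theta> *\<^sub>R B j)"
        using loewner_le_add[OF matfun_mono[OF A g] loewner_le_refl[of "- \<theta> *\<^sub>R B _"]]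
        by (intro loewner_le_sum) simp
    qed (auto intro!: self_adjoint_sum self_adjoint_diff self_adjoint_matfun self_adjoint_scaleR A B)
    show "\<omega> \<in> E Y"
    \<comment> \<open>The sign of the eigenvalue of large modulus decides between the two events: if
      it is negative, the outcome would lie in \<open>E Y'\<close>, which \<open>notin\<close>
      excludes.\<close>
    proof (cases "r i \<ge> 0")
      case True
      then have "exp (\<theta> * t) \<le> exp (\<theta> * r i)"
        using i assms(12) by simp
      also have "\<dots> \<le> retrace (matfun exp (\<theta> *\<^sub>R ?R \<omega>))"
        by (rule exp_le_retrace_exp[OF spectral_decomp_scaleR[OF sd]])
      also have "\<dots> \<le> retrace (matfun exp (\<Sum>j\<in>J. matfun f (\<theta> *\<^sub>R Y j \<omega>) - \<theta> *\<^sub>R integral\<^sup>L M (Y j)))"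
        unfolding R by (rule mono[OF saY saE]) (use assms(5) in \<open>simp_all add: f_def\<close>)
      finally show ?thesis using w by (simp add: E_def)
    next
      case False
      have saY': "self_adjoint (\<theta> *\<^sub>R Y' j \<omega>)" if "j \<in> J" for j
        using self_adjoint_scaleR[OF saY[OF that], of "-1"] by (simp add: Y'_def)
      have neg: "matfun (\<lambda>x. - \<psi> (- x)) (\<theta> *\<^sub>R Y' j \<omega>) = - matfun \<psi> (\<theta> *\<^sub>R Y j \<omega>)" if "j \<in> J" for j
        using matfun_scaleR_arg[OF saY[OF that], of "\<lambda>x. - \<psi> (- x)" "-1"] matfun_scaleR[OF saY[OF that], of "-1" \<psi>]
        by (simp add: Y'_def)
      have saE': "self_adjoint (integral\<^sup>L M (Y' j))" if "j \<in> J" for j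
        using self_adjoint_scaleR[OF saE[OF that], of "-1"] by (simp add: Y'_def)
      have intY': "integral\<^sup>L M (Y' j) = - integral\<^sup>L M (Y j)" for j
        by (simp add: Y'_def)
      have R': "(- \<theta>) *\<^sub>R ?R \<omega> = (\<Sum>j\<in>J. matfun (\<lambda>x. - \<psi> (- x)) (\<theta> *\<^sub>R Y' j \<omega>) - \<theta> *\<^sub>R integral\<^sup>L M (Y' j))"
        using R by (simp add: neg intY' sum_negf[symmetric])
      have psi: "- \<psi> (- x) \<le> f x" for x
        using assms(4)[of "- x"] by (simp add: f_def)
      have "\<theta> * t \<le> \<theta> * (- r i)"
        using False i assms(12) by (intro mult_left_mono) auto
      then have "exp (\<theta> * t) \<le> exp ((- \<theta>) * r i)"
        by simp
      also have "\<dots> \<le> retrace (matfun exp ((- \<theta>) *\<^sub>R ?R \<omega>))"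
        by (rule exp_le_retrace_exp[OF spectral_decomp_scaleR[OF sd]])
      also have "\<dots> \<le> retrace (matfun exp (\<Sum>j\<in>J. matfun f (\<theta> *\<^sub>R Y' j \<omega>) - \<theta> *\<^sub>R integral\<^sup>L M (Y' j)))"
        unfolding R' by (rule mono[OF saY' saE' psi])
      finally show ?thesis using w notin by (simp add: E_def)
    qed
  qed
  \<comment> \<open>Monotonicity of the measure rests on measurability of the covering set, already
    known from continuity of \<open>f\<close>.\<close>
  have "measure M {\<omega> \<in> space M. opnorm (?R \<omega>) \<ge> t} \<le> prob (E Y \<union> E Y')"
    by (rule finite_measure_mono[OF sub]) (use E E' in auto)
  also have "\<dots> \<le> prob (E Y) + prob (E Y')"
    using E E' by (intro measure_Un_le) auto
  also have "\<dots> \<le> 2 * b"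
    using E E' by linarith
  finally show ?thesis
    unfolding J_def b_def by (simp only: mult.assoc)
qed

end
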